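(* Let $(p_n)_{n\ge 2}$ be a sequence of integers with $1\le p_n<n$, and write $k_n=n-p_n$. For each $n$, let $z_1,\dots,z_{p_n}$ be the $p_n$ eigenvalues of the $p_n\times p_n$ upper-left submatrix of an $n\times n$ Haar-distributed unitary matrix; their joint density (with respect to Lebesgue measure on $\{z\in\mathbb{C}:|z|<1\}^{p_n}$) is $$C\prod_{1\le j<k\le p_n}|z_j-z_k|^2\prod_{j=1}^{p_n}(1-|z_j|^2)^{n-p_n-1},$$ where $C$ is a normalizing constant depending on $n$ and $p_n$. Assume that $$n-p_n\to\infty\quad\text{and}\quad \frac{n-p_n}{\log n}\to 0\quad\text{as } n\to\infty.$$ Let $a_n>0$ be determined by $$\frac{1}{(k_n-1)!}\int_0^{a_n}t^{k_n-1}e^{-t}\,dt=\frac{k_n}{n},$$ and set $A_n=(1-a_n/n)^{1/2}$ and $B_n=a_n/(2nk_n)$ (for $n$ large enough). Then $\big(\max_{1\le j\le p_n}|z_j|-A_n\big)/B_n$ converges weakly, as $n\to\infty$, to the Gumbel distribution $\Lambda(x)=\exp(-e^{-x})$, $x\in\mathbb{R}$.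
   Context: A circular unitary matrix is an $n\times n$ random unitary matrix distributed according to Haar measure on the unitary group $U(n)$. Its truncation is the $p_n\times p_n$ submatrix obtained by deleting the last $n-p_n$ rows and columns. Weak convergence means convergence in distribution, i.e. pointwise convergence of the cumulative distribution functions at every continuity point of the limit. *)

theory Defs
  imports
    "HOL-Probability.Probability"
    "Jordan_Normal_Form.Schur_Decomposition"
    "Jordan_Normal_Form.DL_Submatrix"
begin

definition unitary_group :: "nat \<Rightarrow> complex mat set" where
  "unitary_group n = {A \<in> carrier_mat n n. mat_adjoint A * A = 1\<^sub>m n}"

(* The Borel sets of U(n) for the topology it inherits from C^(n x n): pull back the
   product sigma-algebra along the map sending a matrix to the family of its entries. *)
definition unitary_borel :: "nat \<Rightarrow> complex mat measure" where
  "unitary_borel n =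
     vimage_algebra (unitary_group n)
       (\<lambda>A. \<lambda>ij\<in>{..<n} \<times> {..<n}. A $$ ij)
       (Pi\<^sub>M ({..<n} \<times> {..<n}) (\<lambda>_. borel))"

definition haar_measure :: "nat \<Rightarrow> complex mat measure \<Rightarrow> bool" where
  "haar_measure n \<mu> \<longleftrightarrow>
     prob_space \<mu> \<and> sets \<mu> = sets (unitary_borel n) \<and>
     (\<forall>V\<in>unitary_group n. distr \<mu> \<mu> (\<lambda>A. V * A) = \<mu>)"

definition haar_unitary :: "'w measure \<Rightarrow> nat \<Rightarrow> ('w \<Rightarrow> complex mat) \<Rightarrow> bool" where
  "haar_unitary M n U \<longleftrightarrow>
     U \<in> measurable M (unitary_borel n) \<and> haar_measure n (distr M (unitary_borel n) U)"

definition truncation :: "nat \<Rightarrow> complex mat \<Rightarrow> complex mat" where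
  "truncation m A = submatrix A {..<m} {..<m}"

(* z 0, ..., z (m - 1) list the eigenvalues of A with algebraic multiplicity. *)
definition eigenvalue_list :: "complex mat \<Rightarrow> nat \<Rightarrow> (nat \<Rightarrow> complex) \<Rightarrow> bool" where
  "eigenvalue_list A m z \<longleftrightarrow> char_poly A = (\<Prod>j<m. [:- z j, 1:])"

(* Density on C^m, zero outside the m-fold product of the open unit disc; indices run
   over 0, ..., m - 1. The exponent n - m - 1 is only used for m < n. *)
definition truncated_eigenvalue_density ::
    "nat \<Rightarrow> nat \<Rightarrow> real \<Rightarrow> (nat \<Rightarrow> complex) \<Rightarrow> ennreal" where
  "truncated_eigenvalue_density n m C z =
     (if \<forall>j<m. cmod (z j) < 1
      then ennreal (C * (\<Prod>k<m. \<Prod>j<k. (cmod (z j - z k))\<^sup>2)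
                      * (\<Prod>j<m. (1 - (cmod (z j))\<^sup>2) ^ (n - m - 1)))
      else 0)"

definition gumbel_cdf :: "real \<Rightarrow> real" where
  "gumbel_cdf x = exp (- exp (- x))"

end

theory Submission
  imports Defs "HOL-Real_Asymp.Real_Asymp"
begin

text \<open>The squared Vandermonde product expands into signed products of monomials, and distinct monomials
are orthogonal for a rotation-invariant weight. Hence the squared moduli behave, as far as their
maximum is concerned, like independent Beta variables with parameters \<open>j + 1\<close> and \<open>k\<close> for \<open>j < p\<close>, and
the probability that all \<open>|z\<^sub>j|\<^sup>2\<close> are at most \<open>1 - u\<close> is the product of the factors
\<open>1 - P(Bin(j + k, u) \<ge> k)\<close>.

The sum of these binomial tails over \<open>j < p\<close> is exactly \<open>E (S - k)\<^sup>+ / u\<close> for \<open>S\<close> distributed as \<open>Bin(n, u)\<close>.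
Since \<open>k = o(log n)\<close> forces \<open>a / k \<rightarrow> 0\<close>, the term \<open>S = k + 1\<close> dominates, just as \<open>a^k exp(-a) / k!\<close> dominates
the incomplete Gamma integral that defines \<open>a\<close>. Substituting \<open>u = (a / n) (1 - y / k)\<close> with \<open>y \<rightarrow> x\<close>, the
sum tends to \<open>exp(-x)\<close> while each tail tends uniformly to zero, so the product tends to
\<open>exp(-exp(-x))\<close>.\<close>

subsection \<open>Vandermonde determinant\<close>

lemma coeff_prod_monic_linear:
  fixes z :: "nat \<Rightarrow> 'a::idom"
  shows "degree (\<Prod>l<i. [:- z l, 1:]) = i" "coeff (\<Prod>l<i. [:- z l, 1:]) i = 1"
proof -
  show *: "degree (\<Prod>l<i. [:- z l, 1:]) = i"
    by (subst degree_prod_eq_sum_degree) auto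
  have "lead_coeff (\<Prod>l<i. [:- z l, 1:]) = 1"
    by (simp add: lead_coeff_prod)
  with * show "coeff (\<Prod>l<i. [:- z l, 1:]) i = 1" by simp
qed

text \<open>The Vandermonde matrix times the upper unitriangular matrix holding the coefficients of
  \<open>\<Prod>l<i. (x - z l)\<close> is lower triangular, which gives the product side.\<close>

lemma vandermonde_expansion:
  fixes z :: "nat \<Rightarrow> 'a::idom"
  shows "(\<Prod>k<m. \<Prod>j<k. (z k - z j)) = (\<Sum>\<sigma> | \<sigma> permutes {..<m}. of_int (sign \<sigma>) * (\<Prod>j<m. z j ^ \<sigma> j))"
proof -
  define P where "P i = (\<Prod>l<i. [:- z l, 1:])" for i
  define V where "V = mat m m (\<lambda>(j, i). z j ^ i)"
  define T where "T = mat m m (\<lambda>(l, i). coeff (P i) l)"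
  have [simp]: "V \<in> carrier_mat m m" "T \<in> carrier_mat m m" "V * T \<in> carrier_mat m m"
    by (auto simp: V_def T_def)
  have VT: "(V * T) $$ (j, i) = poly (P i) (z j)" if "j < m" "i < m" for i j
  proof -
    have "(V * T) $$ (j, i) = (\<Sum>l<m. z j ^ l * coeff (P i) l)"
      using that by (simp add: V_def T_def scalar_prod_def atLeast0LessThan)
    also have "\<dots> = (\<Sum>l\<le>degree (P i). z j ^ l * coeff (P i) l)"
      using that by (intro sum.mono_neutral_right) (auto simp: P_def coeff_prod_monic_linear(1) coeff_eq_0)
    also have "\<dots> = poly (P i) (z j)"
      by (simp add: poly_altdef mult.commute)
    finally show ?thesis .
  qed
  \<comment> \<open>For \<open>j < i\<close> the point \<open>z j\<close> is a root of
    \<open>P i\<close>, so the entry at \<open>(j, i)\<close> vanishes. On the diagonal the factors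
    \<open>z k - z l\<close> with \<open>l < k\<close> remain.\<close>
  have "det (V * T) = prod_list (diag_mat (V * T))"
    by (rule det_lower_triangular[of m]) (auto simp: VT P_def poly_prod)
  also have "\<dots> = (\<Prod>k<m. \<Prod>j<k. (z k - z j))"
    unfolding prod_list_diag_prod using VT by (simp add: V_def T_def P_def poly_prod atLeast0LessThan)
  also have "det (V * T) = det V * det T"
    by (rule det_mult[of _ m]) auto
  also have "det T = prod_list (diag_mat T)"
    by (rule det_upper_triangular[of _ m]) 
       (auto simp: T_def upper_triangular_def P_def coeff_prod_monic_linear(1) coeff_eq_0)
  also have "\<dots> = 1"
    unfolding prod_list_diag_prod by (simp add: T_def P_def coeff_prod_monic_linear)
  also have "det V = (\<Sum>\<sigma> | \<sigma> permutes {..<m}. of_int (sign \<sigma>) * (\<Prod>j<m. z j ^ \<sigma> j))"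
    unfolding det_def by (auto simp: V_def atLeast0LessThan intro!: sum.cong prod.cong dest: permutes_in_image)
  finally show ?thesis by simp
qed

subsection \<open>Rotation-invariant integrals over the complex plane\<close>

text \<open>Lebesgue measure is determined by the volumes of boxes, and a complex box is the product
  of two real intervals. This identification allows planar integrals to be iterated over real and
  imaginary parts.\<close>

lemma lborel_complex_eq:
  "(lborel :: complex measure) = distr (lborel \<Otimes>\<^sub>M lborel) borel (\<lambda>(x, y). Complex x y)"
proof (rule lborel_eqI)
  fix l u :: complex
  assume le: "\<And>b. b \<in> Basis \<Longrightarrow> l \<bullet> b \<le> u \<bullet> b"
  have le': "Re l \<le> Re u" "Im l \<le> Im u"
    using le[of 1] le[of \<i>] by (simp_all add: Basis_complex_def)
  have [measurable]: "(\<lambda>(x, y). Complex x y) \<in> borel_measurable (lborel \<Otimes>\<^sub>M lborel)"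
    by (simp add: case_prod_beta Complex_eq)
  have "(\<lambda>(x, y). Complex x y) -` box l u \<inter> space (lborel \<Otimes>\<^sub>M lborel) 
      = {Re l<..<Re u} \<times> {Im l<..<Im u}"
    by (auto simp: box_def Basis_complex_def space_pair_measure)
  then show "emeasure (distr (lborel \<Otimes>\<^sub>M lborel) borel (\<lambda>(x, y). Complex x y)) (box l u) 
      = (\<Prod>b\<in>Basis. (u - l) \<bullet> b)"
    using le' by (subst emeasure_distr) 
      (auto simp: lborel.emeasure_pair_measure_Times Basis_complex_def ennreal_mult' complex_i_not_one)
qed simp

lemma nn_integral_lborel_complex:
  fixes f :: "complex \<Rightarrow> ennreal"
  assumes [measurable]: "f \<in> borel_measurable borel"
  shows "(\<integral>\<^sup>+z. f z \<partial>lborel) = (\<integral>\<^sup>+x. \<integral>\<^sup>+y. f (Complex x y) \<partial>lborel \<partial>lborel)"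
    and "(\<integral>\<^sup>+z. f z \<partial>lborel) = (\<integral>\<^sup>+y. \<integral>\<^sup>+x. f (Complex x y) \<partial>lborel \<partial>lborel)"
proof -
  have [measurable]: "(\<lambda>(x, y). Complex x y) \<in> borel_measurable (lborel \<Otimes>\<^sub>M lborel)"
    by (simp add: case_prod_beta Complex_eq)
  have *: "(\<integral>\<^sup>+z. f z \<partial>lborel) = (\<integral>\<^sup>+(x, y). f (Complex x y) \<partial>(lborel \<Otimes>\<^sub>M lborel))"
    by (subst lborel_complex_eq) (simp add: nn_integral_distr case_prod_beta')
  have [measurable]: "(\<lambda>(x, y). f (Complex x y)) \<in> borel_measurable (lborel \<Otimes>\<^sub>M lborel)"
    unfolding case_prod_beta Complex_eq by measurable
  show "(\<integral>\<^sup>+z. f z \<partial>lborel) = (\<integral>\<^sup>+x. \<integral>\<^sup>+y. f (Complex x y) \<partial>lborel \<partial>lborel)"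
    unfolding * by (subst lborel.nn_integral_fst[symmetric]) auto
  show "(\<integral>\<^sup>+z. f z \<partial>lborel) = (\<integral>\<^sup>+y. \<integral>\<^sup>+x. f (Complex x y) \<partial>lborel \<partial>lborel)"
    unfolding * by (subst lborel_pair.nn_integral_snd[symmetric]) auto
qed

text \<open>For a fixed imaginary part the shear translates the real part, and one-dimensional
  Lebesgue measure is translation invariant. The real part is therefore integrated first.\<close>

lemma lborel_shear_Re:
  "distr lborel lborel (\<lambda>z. Complex (Re z + t * Im z) (Im z)) = lborel" (is "distr _ _ ?S = _")
proof (rule measure_eqI)
  have [measurable]: "?S \<in> borel_measurable borel"
    by (simp add: Complex_eq)
  fix X assume "X \<in> sets (distr lborel lborel ?S)"
  then have [measurable]: "X \<in> sets borel" by simp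
  have "emeasure (distr lborel lborel ?S) X = (\<integral>\<^sup>+z. indicator X (?S z) \<partial>lborel)"
    by (simp add: nn_integral_distr flip: nn_integral_indicator)
  \<comment> \<open>The factor 1 brings the argument into the affine form that
    \<open>nn_integral_real_affine\<close> matches.\<close>
  also have "\<dots> = (\<integral>\<^sup>+y. \<integral>\<^sup>+x. indicator X (Complex (t * y + 1 * x) y) \<partial>lborel \<partial>lborel)"
    by (subst nn_integral_lborel_complex(2)) (auto simp: add.commute)
  also have "\<dots> = (\<integral>\<^sup>+y. \<integral>\<^sup>+x. indicator X (Complex x y) \<partial>lborel \<partial>lborel)"
  proof (rule nn_integral_cong)
    fix y
    have [measurable]: "(\<lambda>x. Complex x y) \<in> borel_measurable borel"
      by (simp add: Complex_eq)
    show "(\<integral>\<^sup>+x. indicator X (Complex (t * y + 1 * x) y) \<partial>lborel)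
        = (\<integral>\<^sup>+x. indicator X (Complex x y) \<partial>lborel)"
      by (subst (2) nn_integral_real_affine[where c = 1 and t = "t * y"]) auto
  qed
  also have "\<dots> = (\<integral>\<^sup>+z. indicator X z \<partial>lborel)"
    by (subst nn_integral_lborel_complex(2)) auto
  finally show "emeasure (distr lborel lborel ?S) X = emeasure lborel X"
    by simp
qed simp

text \<open>The same argument with the order of integration exchanged.\<close>

lemma lborel_shear_Im:
  "distr lborel lborel (\<lambda>z. Complex (Re z) (Im z + t * Re z)) = lborel" (is "distr _ _ ?S = _")
proof (rule measure_eqI)
  have [measurable]: "?S \<in> borel_measurable borel"
    by (simp add: Complex_eq)
  fix X assume "X \<in> sets (distr lborel lborel ?S)"
  then have [measurable]: "X \<in> sets borel" by simp
  have "emeasure (distr lborel lborel ?S) X = (\<integral>\<^sup>+z. indicator X (?S z) \<partial>lborel)"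
    by (simp add: nn_integral_distr flip: nn_integral_indicator)
  also have "\<dots> = (\<integral>\<^sup>+x. \<integral>\<^sup>+y. indicator X (Complex x (t * x + 1 * y)) \<partial>lborel \<partial>lborel)"
    by (subst nn_integral_lborel_complex(1)) (auto simp: add.commute)
  also have "\<dots> = (\<integral>\<^sup>+x. \<integral>\<^sup>+y. indicator X (Complex x y) \<partial>lborel \<partial>lborel)"
  proof (rule nn_integral_cong)
    fix x
    have [measurable]: "(\<lambda>y. Complex x y) \<in> borel_measurable borel"
      by (simp add: Complex_eq)
    show "(\<integral>\<^sup>+y. indicator X (Complex x (t * x + 1 * y)) \<partial>lborel)
        = (\<integral>\<^sup>+y. indicator X (Complex x y) \<partial>lborel)"
      by (subst (2) nn_integral_real_affine[where c = 1 and t = "t * x"]) auto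
  qed
  also have "\<dots> = (\<integral>\<^sup>+z. indicator X z \<partial>lborel)"
    by (subst nn_integral_lborel_complex(1)) auto
  finally show "emeasure (distr lborel lborel ?S) X = emeasure lborel X"
    by simp
qed simp

text \<open>A plane rotation is a product of three shears.\<close>

lemma lborel_rotation:
  assumes "cmod \<zeta> = 1" "Im \<zeta> \<noteq> 0"
  shows "distr lborel lborel ((*) \<zeta>) = lborel"
proof -
  define c s where "c = Re \<zeta>" and "s = Im \<zeta>"
  have cs: "c\<^sup>2 + s\<^sup>2 = 1" "s \<noteq> 0"
    using assms unfolding c_def s_def by (auto simp: cmod_def)
  \<comment> \<open>The tangent of half the rotation angle. The shears along the real axis use
    \<open>- t\<close> and the middle one uses \<open>s\<close>; the quotient requires
    \<open>s\<close> to be nonzero.\<close>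
  define t where "t = (1 - c) / s"
  have st: "s * t = 1 - c" "t * (1 + c) = s"
  proof -
    show "s * t = 1 - c" using cs by (simp add: t_def)
    have "(1 - c) * (1 + c) = s\<^sup>2" using cs by (simp add: algebra_simps power2_eq_square)
    then show "t * (1 + c) = s" using cs by (simp add: t_def power2_eq_square)
  qed
  define F where "F = (\<lambda>z. Complex (Re z + - t * Im z) (Im z))"
  define G where "G = (\<lambda>z. Complex (Re z) (Im z + s * Re z))"
  have [measurable]: "F \<in> borel_measurable borel" "G \<in> borel_measurable borel"
    by (simp_all add: F_def G_def Complex_eq)
  have "(*) \<zeta> = F \<circ> (G \<circ> F)"
  proof
    fix z
    have 1: "Im z + s * (Re z - t * Im z) = s * Re z + c * Im z"
    proof -
      have "Im z + s * (Re z - t * Im z) = s * Re z + (1 - s * t) * Im z" by (simp add: algebra_simps)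
      then show ?thesis using st by simp
    qed
    have 2: "Re z - t * Im z - t * (s * Re z + c * Im z) = c * Re z - s * Im z"
    proof -
      have "Re z - t * Im z - t * (s * Re z + c * Im z) = (1 - s * t) * Re z - (t * (1 + c)) * Im z" by (simp add: algebra_simps)
      then show ?thesis using st by simp
    qed
    have FGF: "(F \<circ> (G \<circ> F)) z = Complex (c * Re z - s * Im z) (s * Re z + c * Im z)"
      using 1 2 by (simp add: F_def G_def)
    show "\<zeta> * z = (F \<circ> (G \<circ> F)) z"
      unfolding FGF by (simp add: complex_eq_iff c_def s_def algebra_simps)
  qed
  moreover have "distr lborel lborel (F \<circ> (G \<circ> F)) = distr (distr (distr lborel lborel F) lborel G) lborel F"
    by (simp add: distr_distr)
  moreover have "distr lborel lborel F = lborel" "distr lborel lborel G = lborel"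
    unfolding F_def G_def by (rule lborel_shear_Re lborel_shear_Im)+
  ultimately show ?thesis by simp
qed

text \<open>A disc of radius \<open>sqrt s\<close> has area \<open>pi * s\<close>, linear in
  \<open>s\<close>. Agreement on the half-lines \<open>{..s}\<close> suffices, because they are
  closed under intersection and generate the Borel sets.\<close>

lemma distr_lborel_cmod_square:
  "distr lborel borel (\<lambda>z::complex. (cmod z)\<^sup>2) = density lborel (\<lambda>s. ennreal pi * indicator {0..} s)"
    (is "?M = ?N")
proof -
  have ball: "(\<lambda>z::complex. (cmod z)\<^sup>2) -` {..s} = cball 0 (sqrt s)" if "s \<ge> 0" for s
  proof -
    have "(cmod z)\<^sup>2 \<le> s \<longleftrightarrow> cmod z \<le> sqrt s" for z
      by (metis abs_norm_cancel real_sqrt_abs real_sqrt_le_iff)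
    then show ?thesis by auto
  qed
  show ?thesis
  proof (rule measure_eqI_generator_eq[where E = "range atMost" and A = "\<lambda>i. {..real i}" and \<Omega> = UNIV])
    have eq: "emeasure ?M {..s} = emeasure ?N {..s}" for s
    proof (cases "s \<ge> 0")
      case True
      then have "emeasure ?M {..s} = ennreal (pi * s)"
        using ball[of s] by (simp add: emeasure_distr emeasure_cball unit_ball_vol_2)
      moreover have "emeasure ?N {..s} = (\<integral>\<^sup>+x. ennreal pi * indicator {0..s} x \<partial>lborel)"
        by (simp add: emeasure_density) (auto intro!: nn_integral_cong simp: indicator_def)
      moreover have "\<dots> = ennreal (pi * s)"
        using True by (simp add: nn_integral_cmult ennreal_mult')
      ultimately show ?thesis by simp
    next
      case False
      have "s < (cmod z)\<^sup>2" for z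
        using False zero_le_power2[of "cmod z"] by linarith
      then have "(\<lambda>z::complex. (cmod z)\<^sup>2) -` {..s} = {}"
        by (simp add: not_le vimage_def)
      then have "emeasure ?M {..s} = 0"
        by (simp add: emeasure_distr)
      moreover have "emeasure ?N {..s} = (\<integral>\<^sup>+x. ennreal pi * indicator {0..} x * indicator {..s} x \<partial>lborel)"
        by (simp add: emeasure_density)
      moreover have "\<dots> = (\<integral>\<^sup>+x. 0 \<partial>(lborel :: real measure))"
        using False by (intro nn_integral_cong) (auto simp: indicator_def)
      ultimately show ?thesis by simp
    qed
    then show "\<And>X. X \<in> range atMost \<Longrightarrow> emeasure ?M X = emeasure ?N X" by auto
    show "emeasure ?M {..real i} \<noteq> \<infinity>" for i
      using ball[of "real i"] by (simp add: emeasure_distr emeasure_cball)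
    show "Int_stable (range (atMost :: real \<Rightarrow> _))"
      by (auto simp: Int_stable_def)
    show "(\<Union>i. {..real i}) = (UNIV :: real set)"
      by (auto intro: real_arch_simple)
  qed (auto simp: borel_eq_atMost)
qed

text \<open>The weight vanishes outside the closed unit disc and everything is at most 1 in modulus
  inside it, so the indicator of the disc dominates.\<close>

lemma integrable_monomial_radial:
  fixes g :: "real \<Rightarrow> real"
  assumes [measurable]: "g \<in> borel_measurable borel" 
    and g1: "\<And>s. s \<ge> 0 \<Longrightarrow> \<bar>g s\<bar> \<le> 1" and g0: "\<And>s. s > 1 \<Longrightarrow> g s = 0"
  shows "integrable lborel (\<lambda>z. z ^ a * cnj z ^ b * complex_of_real (g ((cmod z)\<^sup>2)))"
proof (rule Bochner_Integration.integrable_bound)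
  show "integrable lborel (indicator (cball 0 1) :: complex \<Rightarrow> real)"
    by (simp add: emeasure_cball integrable_indicator_iff)
  have [measurable]: "cnj \<in> borel_measurable borel"
    by (intro borel_measurable_continuous_onI continuous_intros)
  show "(\<lambda>z. z ^ a * cnj z ^ b * complex_of_real (g ((cmod z)\<^sup>2))) \<in> borel_measurable lborel"
    by measurable
  have "norm (z ^ a * cnj z ^ b * complex_of_real (g ((cmod z)\<^sup>2))) \<le> norm (indicator (cball 0 1) z :: real)" for z
  proof (cases "cmod z \<le> 1")
    case True
    then have "cmod z ^ a * cmod z ^ b * \<bar>g ((cmod z)\<^sup>2)\<bar> \<le> 1 * 1 * 1"
      by (intro mult_mono g1) (auto simp: power_le_one)
    then show ?thesis using True by (simp add: norm_mult norm_power)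
  next
    case False
    then have "(cmod z)\<^sup>2 > 1" by (simp add: one_less_power)
    then show ?thesis using g0 by simp
  qed
  then show "AE z in lborel. norm (z ^ a * cnj z ^ b * complex_of_real (g ((cmod z)\<^sup>2))) 
      \<le> norm (indicator (cball 0 1) z :: real)"
    by simp
qed

text \<open>A rotation leaves Lebesgue measure and the radial weight unchanged but multiplies the
  monomial by a phase. When the phase differs from 1, the integral must be zero.\<close>

lemma integral_monomial_radial_offdiag:
  fixes g :: "real \<Rightarrow> real"
  assumes [measurable]: "g \<in> borel_measurable borel" and ab: "a \<noteq> b"
  shows "(\<integral>z. z ^ a * cnj z ^ b * complex_of_real (g ((cmod z)\<^sup>2)) \<partial>lborel) = 0" (is "?I = 0")
proof -
  \<comment> \<open>Makes the total phase angle equal to \<open>pi / 2\<close>. Since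
    \<open>a\<close> and \<open>b\<close> differ by at least 1, \<open>\<theta>\<close> has modulus
    at most \<open>pi / 2\<close>, so its sine is nonzero, as the decomposition into shears demands.
    Aiming at the phase -1 would fail when the exponents differ by exactly 1.\<close>
  define \<theta> where "\<theta> = pi / 2 / (real a - real b)"
  have [measurable]: "cnj \<in> borel_measurable borel"
    by (intro borel_measurable_continuous_onI continuous_intros)
  have "sin \<theta> \<noteq> 0"
  proof -
    have 1: "\<bar>real a - real b\<bar> \<ge> 1" using ab by linarith
    have "\<bar>\<theta>\<bar> = pi / 2 / \<bar>real a - real b\<bar>" by (simp only: \<theta>_def abs_divide) simp
    also have "\<dots> \<le> pi / 2 / 1" using 1 by (intro divide_left_mono) auto
    finally have "\<bar>\<theta>\<bar> < pi" using pi_gt_zero by linarith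
    moreover have "\<theta> \<noteq> 0" using ab by (simp add: \<theta>_def)
    ultimately show ?thesis
      by (metis abs_if linorder_neqE_linordered_idom minus_equation_iff neg_0_less_iff_less sin_gt_zero sin_minus less_irrefl neg_equal_zero)
  qed
  then have rot: "distr lborel lborel ((*) (cis \<theta>)) = lborel"
    by (intro lborel_rotation) auto
  have phase: "cis \<theta> ^ a * cnj (cis \<theta>) ^ b = \<i>"
  proof -
    have "cis \<theta> ^ a * cnj (cis \<theta>) ^ b = cis (\<theta> * (real a - real b))"
      by (simp only: cis_cnj Complex.DeMoivre cis_mult) (simp add: algebra_simps)
    also have "\<theta> * (real a - real b) = pi / 2"
      unfolding \<theta>_def by (rule nonzero_eq_divide_eq[THEN iffD1]) (use ab in auto)
    finally show ?thesis by simp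
  qed
  have "?I = (\<integral>z. z ^ a * cnj z ^ b * complex_of_real (g ((cmod z)\<^sup>2)) \<partial>(distr lborel lborel ((*) (cis \<theta>))))"
    by (simp add: rot)
  also have "\<dots> = (\<integral>z. (cis \<theta> * z) ^ a * cnj (cis \<theta> * z) ^ b * complex_of_real (g ((cmod (cis \<theta> * z))\<^sup>2)) \<partial>lborel)"
    by (rule integral_distr) auto
  also have "\<dots> = (\<integral>z. (cis \<theta> ^ a * cnj (cis \<theta>) ^ b) * (z ^ a * cnj z ^ b * complex_of_real (g ((cmod z)\<^sup>2))) \<partial>lborel)"
    by (simp add: norm_mult power_mult_distrib mult_ac)
  also have "\<dots> = \<i> * ?I" unfolding phase by simp
  finally have "(1 - \<i>) * ?I = 0" by (simp add: algebra_simps)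
  moreover have "1 - \<i> \<noteq> 0" by (simp add: complex_eq_iff)
  ultimately show ?thesis by simp
qed

text \<open>With equal exponents the monomial is a power of the squared modulus, so the integral is
  carried to the half-line by the image measure of the squared modulus.\<close>

lemma integral_monomial_radial_diag:
  fixes g :: "real \<Rightarrow> real"
  assumes [measurable]: "g \<in> borel_measurable borel"
  shows "(\<integral>z. z ^ a * cnj z ^ a * complex_of_real (g ((cmod z)\<^sup>2)) \<partial>lborel) 
    = complex_of_real (pi * (\<integral>s. indicator {0..} s * (s ^ a * g s) \<partial>lborel))"
proof -
  have "z ^ a * cnj z ^ a = complex_of_real (((cmod z)\<^sup>2) ^ a)" for z
    by (simp only: of_real_power[of "(cmod z)\<^sup>2"] complex_norm_square power_mult_distrib)
  then have "(\<integral>z. z ^ a * cnj z ^ a * complex_of_real (g ((cmod z)\<^sup>2)) \<partial>lborel) 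
    = (\<integral>z. complex_of_real (((cmod z)\<^sup>2) ^ a * g ((cmod z)\<^sup>2)) \<partial>lborel)"
    by simp
  also have "\<dots> = complex_of_real (\<integral>z. ((cmod z)\<^sup>2) ^ a * g ((cmod z)\<^sup>2) \<partial>lborel)"
    by (rule integral_complex_of_real)
  also have "(\<integral>z. ((cmod z)\<^sup>2) ^ a * g ((cmod z)\<^sup>2) \<partial>lborel) = 
      (\<integral>s. s ^ a * g s \<partial>(distr lborel borel (\<lambda>z::complex. (cmod z)\<^sup>2)))"
    by (subst integral_distr) auto
  also have "\<dots> = (\<integral>s. s ^ a * g s \<partial>(density lborel (\<lambda>s. ennreal (pi * indicator {0..} s))))"
    unfolding distr_lborel_cmod_square by (simp add: ennreal_mult' ennreal_indicator)
  also have "\<dots> = (\<integral>s. pi * (indicator {0..} s * (s ^ a * g s)) \<partial>lborel)"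
    by (subst integral_density) (auto simp: mult_ac)
  also have "\<dots> = pi * (\<integral>s. indicator {0..} s * (s ^ a * g s) \<partial>lborel)"
    by simp
  finally show ?thesis .
qed

section \<open>Squared Vandermonde products against radial weights\<close>

text \<open>Expanding the Vandermonde product and its conjugate gives a double sum over permutations
  whose terms factor into one-variable integrals. Orthogonality removes all terms except the
  \<open>m!\<close> diagonal ones; each of these is the product of all \<open>h j\<close>, since a
  permutation only reorders the factors.\<close>

lemma integral_vandermonde_square:
  fixes w :: "complex \<Rightarrow> real"
  assumes "sigma_finite_measure N"
    and int: "\<And>a b. integrable N (\<lambda>z. z ^ a * cnj z ^ b * complex_of_real (w z))"
    and orth: "\<And>a b. (\<integral>z. z ^ a * cnj z ^ b * complex_of_real (w z) \<partial>N) 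
                  = (if a = b then complex_of_real (h a) else 0)"
  shows "integrable (Pi\<^sub>M {..<m} (\<lambda>_. N)) (\<lambda>z. (\<Prod>k<m. \<Prod>j<k. (cmod (z j - z k))\<^sup>2) * (\<Prod>j<m. w (z j)))"
      (is "integrable ?P ?f")
    and "(\<integral>z. (\<Prod>k<m. \<Prod>j<k. (cmod (z j - z k))\<^sup>2) * (\<Prod>j<m. w (z j)) \<partial>Pi\<^sub>M {..<m} (\<lambda>_. N)) 
      = fact m * (\<Prod>j<m. h j)"
proof -
  interpret sigma_finite_measure N by fact
  interpret product_sigma_finite "\<lambda>_. N" by unfold_locales
  define S where "S = {\<sigma>. \<sigma> permutes {..<m}}"
  define t where "t \<sigma> \<tau> z = of_int (sign \<sigma> * sign \<tau>) * 
      (\<Prod>j<m. z j ^ \<sigma> j * cnj (z j) ^ \<tau> j * complex_of_real (w (z j)))" for \<sigma> \<tau> and z :: "nat \<Rightarrow> complex"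
  have [simp]: "finite S" by (simp add: S_def finite_permutations)
  have cardS: "card S = fact m" unfolding S_def by (subst card_permutations[of "{..<m}" m]) auto
  have expand: "complex_of_real (?f z) = (\<Sum>\<sigma>\<in>S. \<Sum>\<tau>\<in>S. t \<sigma> \<tau> z)" for z
  proof -
    have "complex_of_real ((cmod (z j - z k))\<^sup>2) = (z k - z j) * cnj (z k - z j)" for j k
      by (metis complex_norm_square norm_minus_commute)
    then have "complex_of_real (\<Prod>k<m. \<Prod>j<k. (cmod (z j - z k))\<^sup>2) 
        = (\<Prod>k<m. \<Prod>j<k. (z k - z j)) * cnj (\<Prod>k<m. \<Prod>j<k. (z k - z j))"
      by (simp add: prod.distrib)
    also have "\<dots> = (\<Sum>\<sigma>\<in>S. of_int (sign \<sigma>) * (\<Prod>j<m. z j ^ \<sigma> j)) * (\<Sum>\<tau>\<in>S. of_int (sign \<tau>) * (\<Prod>j<m. cnj (z j) ^ \<tau> j))"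
      unfolding vandermonde_expansion S_def by simp
    also have "\<dots> = (\<Sum>\<sigma>\<in>S. \<Sum>\<tau>\<in>S. of_int (sign \<sigma> * sign \<tau>) * (\<Prod>j<m. z j ^ \<sigma> j * cnj (z j) ^ \<tau> j))"
      by (simp add: sum_product prod.distrib mult_ac)
    finally show ?thesis
      by (simp add: t_def sum_distrib_left sum_distrib_right prod.distrib mult_ac)
  qed
  have int_t: "integrable ?P (t \<sigma> \<tau>)" for \<sigma> \<tau>
    unfolding t_def by (intro integrable_mult_right product_integrable_prod int) auto
  have "integrable ?P (\<lambda>z. complex_of_real (?f z))"
    unfolding expand by (intro Bochner_Integration.integrable_sum int_t)
  from integrable_Re[OF this] show "integrable ?P ?f" by (simp only: Re_complex_of_real)
  have integral_t: "integral\<^sup>L ?P (t \<sigma> \<tau>) = (if \<sigma> = \<tau> then complex_of_real (\<Prod>j<m. h j) else 0)" 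
    if "\<sigma> \<in> S" "\<tau> \<in> S" for \<sigma> \<tau>
  proof -
    have "integral\<^sup>L ?P (t \<sigma> \<tau>) = of_int (sign \<sigma> * sign \<tau>) * 
      (\<Prod>j<m. \<integral>z. z ^ \<sigma> j * cnj z ^ \<tau> j * complex_of_real (w z) \<partial>N)"
      unfolding t_def by (subst product_integral_prod[symmetric]) (auto intro: int)
    also have "\<dots> = of_int (sign \<sigma> * sign \<tau>) * (\<Prod>j<m. if \<sigma> j = \<tau> j then complex_of_real (h (\<sigma> j)) else 0)"
      unfolding orth ..
    also have "\<dots> = (if \<sigma> = \<tau> then complex_of_real (\<Prod>j<m. h j) else 0)"
    proof (cases "\<sigma> = \<tau>")
      case True
      have "(\<Prod>j<m. h (\<sigma> j)) = (\<Prod>j<m. h j)"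
        using that(1) prod.permute[of \<sigma> "{..<m}" h] by (simp add: S_def comp_def)
      moreover have "sign \<sigma> * sign \<sigma> = 1"
        by (simp add: sign_def)
      ultimately show ?thesis using True by (simp flip: of_real_prod of_int_mult)
    next
      case False
      then obtain j where "\<sigma> j \<noteq> \<tau> j" by blast
      \<comment> \<open>Both permutations fix every index from \<open>m\<close> on, so they can only
        disagree below \<open>m\<close>. The factor at such an index is zero.\<close>
      then have "j < m" using that unfolding S_def by (metis lessThan_iff mem_Collect_eq permutes_not_in)
      with \<open>\<sigma> j \<noteq> \<tau> j\<close> False show ?thesis by (auto intro!: prod_zero)
    qed
    finally show ?thesis .
  qed
  have "complex_of_real (integral\<^sup>L ?P ?f) = (\<integral>z. complex_of_real (?f z) \<partial>?P)"
    by (rule integral_complex_of_real[symmetric])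
  also have "\<dots> = (\<Sum>\<sigma>\<in>S. \<Sum>\<tau>\<in>S. integral\<^sup>L ?P (t \<sigma> \<tau>))"
    unfolding expand by (simp add: Bochner_Integration.integral_sum int_t Bochner_Integration.integrable_sum)
  also have "\<dots> = (\<Sum>\<sigma>\<in>S. \<Sum>\<tau>\<in>S. if \<sigma> = \<tau> then complex_of_real (\<Prod>j<m. h j) else 0)"
    by (intro sum.cong refl integral_t)
  also have "\<dots> = complex_of_real (fact m * (\<Prod>j<m. h j))"
    by (simp add: cardS)
  finally show "integral\<^sup>L ?P ?f = fact m * (\<Prod>j<m. h j)"
    by (simp only: of_real_eq_iff)
qed

text \<open>The form needed for densities, which are given by nonnegative integrals: the base
  measure is planar Lebesgue measure, and the moments \<open>h j\<close> become integrals over the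
  half-line.\<close>

lemma nn_integral_vandermonde_radial:
  fixes g :: "real \<Rightarrow> real"
  assumes [measurable]: "g \<in> borel_measurable borel" 
    and g01: "\<And>s. s \<ge> 0 \<Longrightarrow> 0 \<le> g s \<and> g s \<le> 1" and g0: "\<And>s. s > 1 \<Longrightarrow> g s = 0" and c: "c \<ge> 0"
  shows "(\<integral>\<^sup>+z. ennreal (c * (\<Prod>k<m. \<Prod>j<k. (cmod (z j - z k))\<^sup>2) * (\<Prod>j<m. g ((cmod (z j))\<^sup>2))) 
             \<partial>Pi\<^sub>M {..<m} (\<lambda>_. lborel))
       = ennreal (c * fact m * (\<Prod>j<m. pi * (\<integral>s. indicator {0..} s * (s ^ j * g s) \<partial>lborel)))"
proof -
  note * = integral_vandermonde_square[of lborel "\<lambda>z. g ((cmod z)\<^sup>2)" 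
    "\<lambda>j. pi * (\<integral>s. indicator {0..} s * (s ^ j * g s) \<partial>lborel)" m,
    OF lborel.sigma_finite_measure_axioms integrable_monomial_radial]
  have orth: "(\<integral>z. z ^ a * cnj z ^ b * complex_of_real (g ((cmod z)\<^sup>2)) \<partial>lborel) =
     (if a = b then complex_of_real (pi * (\<integral>s. indicator {0..} s * (s ^ a * g s) \<partial>lborel)) else 0)" for a b
    using integral_monomial_radial_offdiag[of g a b] integral_monomial_radial_diag[of g a]
    by (cases "a = b") simp_all
  have g1: "\<bar>g s\<bar> \<le> 1" if "s \<ge> 0" for s using g01[OF that] by simp
  have "(\<integral>\<^sup>+z. ennreal (c * ((\<Prod>k<m. \<Prod>j<k. (cmod (z j - z k))\<^sup>2) * (\<Prod>j<m. g ((cmod (z j))\<^sup>2)))) 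
             \<partial>Pi\<^sub>M {..<m} (\<lambda>_. lborel))
    = ennreal (\<integral>z. c * ((\<Prod>k<m. \<Prod>j<k. (cmod (z j - z k))\<^sup>2) * (\<Prod>j<m. g ((cmod (z j))\<^sup>2)))
             \<partial>Pi\<^sub>M {..<m} (\<lambda>_. lborel))"
    using c g01 by (intro nn_integral_eq_integral integrable_mult_right *(1) orth AE_I2 mult_nonneg_nonneg prod_nonneg)
      (auto simp: g1 g0)
  also have "\<dots> = ennreal (c * (fact m * (\<Prod>j<m. pi * (\<integral>s. indicator {0..} s * (s ^ j * g s) \<partial>lborel))))"
    by (subst integral_mult_right_zero, subst *(2)) (use orth g1 g0 in auto)
  finally show ?thesis by (simp add: mult.assoc)
qed

subsection \<open>Binomial tails\<close>

text \<open>The expectation of \<open>f\<close> at a \<open>Bin(n, u)\<close> variable, written as a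
  polynomial so that it can be differentiated at every real \<open>u\<close>.\<close>

definition binomial_mean :: "real \<Rightarrow> nat \<Rightarrow> (nat \<Rightarrow> real) \<Rightarrow> real" where
  "binomial_mean u n f = (\<Sum>i\<le>n. f i * (real (n choose i) * u ^ i * (1 - u) ^ (n - i)))"

lemma binomial_mean_0 [simp]: "binomial_mean u 0 f = f 0"
  by (simp add: binomial_mean_def)

lemma binomial_mean_add:
  "binomial_mean u n (\<lambda>i. f i + g i) = binomial_mean u n f + binomial_mean u n g"
  by (simp add: binomial_mean_def sum.distrib algebra_simps)

lemma binomial_mean_diff:
  "binomial_mean u n (\<lambda>i. f i - g i) = binomial_mean u n f - binomial_mean u n g"
  by (simp add: binomial_mean_def sum_subtractf algebra_simps)

lemma binomial_mean_cmult: "binomial_mean u n (\<lambda>i. c * f i) = c * binomial_mean u n f"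
  by (simp add: binomial_mean_def sum_distrib_left mult_ac)

lemma binomial_mean_mono:
  assumes "0 \<le> u" "u \<le> 1" "\<And>i. i \<le> n \<Longrightarrow> f i \<le> g i"
  shows "binomial_mean u n f \<le> binomial_mean u n g"
  unfolding binomial_mean_def using assms by (intro sum_mono mult_right_mono) auto

text \<open>Conditioning on one Bernoulli step; in terms of coefficients, Pascal's rule.\<close>

lemma binomial_mean_Suc:
  "binomial_mean u (Suc n) f = u * binomial_mean u n (\<lambda>i. f (Suc i)) + (1 - u) * binomial_mean u n f"
proof -
  have "binomial_mean u (Suc n) f = f 0 * (1 - u) ^ Suc n + 
      (\<Sum>i\<le>n. f (Suc i) * (real (Suc n choose Suc i) * u ^ Suc i * (1 - u) ^ (n - i)))"
    unfolding binomial_mean_def by (subst sum.atMost_Suc_shift) simp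
  also have "\<dots> = u * binomial_mean u n (\<lambda>i. f (Suc i)) + (f 0 * (1 - u) ^ Suc n + 
      (\<Sum>i\<le>n. f (Suc i) * (real (n choose Suc i) * u ^ Suc i * (1 - u) ^ (n - i))))"
    by (simp add: binomial_mean_def sum.distrib sum_distrib_left algebra_simps)
  \<comment> \<open>The range extends to \<open>Suc n\<close> at no cost, because
    \<open>n choose Suc n\<close> is zero.\<close>
  also have "f 0 * (1 - u) ^ Suc n + 
      (\<Sum>i\<le>n. f (Suc i) * (real (n choose Suc i) * u ^ Suc i * (1 - u) ^ (n - i)))
    = (\<Sum>i\<le>Suc n. f i * (real (n choose i) * u ^ i * (1 - u) ^ (Suc n - i)))"
    by (subst sum.atMost_Suc_shift) simp
  also have "\<dots> = (1 - u) * binomial_mean u n f"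
    by (simp add: binomial_mean_def sum_distrib_left Suc_diff_le mult_ac)
  finally show ?thesis .
qed

text \<open>Induction through the one-step recursion: the terms from the product rule recombine, by
  the same recursion, into the mean of the forward difference of \<open>f\<close>.\<close>

lemma has_real_derivative_binomial_mean:
  "((\<lambda>u. binomial_mean u (Suc n) f) has_real_derivative 
      real (Suc n) * binomial_mean u n (\<lambda>i. f (Suc i) - f i)) (at u)"
proof (induction n arbitrary: f)
  case 0
  then show ?case
    by (auto simp: binomial_mean_Suc intro!: derivative_eq_intros)
next
  case (Suc n)
  have "((\<lambda>u. u * binomial_mean u (Suc n) (\<lambda>i. f (Suc i)) + (1 - u) * binomial_mean u (Suc n) f) 
      has_real_derivative 
     (binomial_mean u (Suc n) (\<lambda>i. f (Suc i)) + u * (real (Suc n) * binomial_mean u n (\<lambda>i. f (Suc (Suc i)) - f (Suc i)))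
     - binomial_mean u (Suc n) f + (1 - u) * (real (Suc n) * binomial_mean u n (\<lambda>i. f (Suc i) - f i)))) (at u)"
    by (rule derivative_eq_intros Suc.IH refl | simp)+
  moreover have "binomial_mean u (Suc n) (\<lambda>i. f (Suc i)) - binomial_mean u (Suc n) f 
      = binomial_mean u (Suc n) (\<lambda>i. f (Suc i) - f i)"
    by (simp add: binomial_mean_diff)
  moreover have "u * binomial_mean u n (\<lambda>i. f (Suc (Suc i)) - f (Suc i)) + (1 - u) * binomial_mean u n (\<lambda>i. f (Suc i) - f i) 
      = binomial_mean u (Suc n) (\<lambda>i. f (Suc i) - f i)"
    by (rule binomial_mean_Suc[symmetric])
  moreover have "A + u * (c * X) - F + (1 - u) * (c * Y) = (1 + c) * D"
    if "A - F = D" "u * X + (1 - u) * Y = D" for A F D X Y c :: real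
  proof -
    have "A + u * (c * X) - F + (1 - u) * (c * Y) = (A - F) + c * (u * X + (1 - u) * Y)"
      by (simp add: algebra_simps)
    then show ?thesis unfolding that by (simp add: algebra_simps)
  qed
  ultimately show ?case
    unfolding binomial_mean_Suc[of _ "Suc n" f] of_nat_Suc[of "Suc n"]
    by (elim DERIV_cong)
qed

definition binomial_tail :: "real \<Rightarrow> nat \<Rightarrow> nat \<Rightarrow> real" where
  "binomial_tail u n k = binomial_mean u n (\<lambda>i. of_bool (k \<le> i))"

lemma binomial_mean_const: "binomial_mean u n (\<lambda>_. c) = c"
  by (induction n) (simp_all add: binomial_mean_Suc algebra_simps)

lemma binomial_tail_bounds:
  assumes "0 \<le> u" "u \<le> 1"
  shows "0 \<le> binomial_tail u n k" "binomial_tail u n k \<le> 1"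
  using binomial_mean_mono[OF assms, of n "\<lambda>_. 0" "\<lambda>i. of_bool (k \<le> i)"]
    binomial_mean_mono[OF assms, of n "\<lambda>i. of_bool (k \<le> i)" "\<lambda>_. 1"]
  by (simp_all add: binomial_mean_const binomial_tail_def)

lemma binomial_tail_eq_0: "n < k \<Longrightarrow> binomial_tail u n k = 0"
  by (simp add: binomial_tail_def binomial_mean_def)

lemma binomial_tail_1:
  assumes "k \<le> n"
  shows "binomial_tail 1 n k = 1"
proof -
  have "binomial_mean 1 n f = f n" for f
    by (induction n arbitrary: f) (simp_all add: binomial_mean_Suc)
  with assms show ?thesis by (simp add: binomial_tail_def)
qed

text \<open>The forward difference of the indicator of \<open>k <= i\<close> is the indicator of the
  single point \<open>k - 1\<close>, so one binomial probability survives. The result is the Beta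
  density with parameters \<open>k\<close> and \<open>j + 1\<close>.\<close>

lemma has_real_derivative_binomial_tail:
  assumes "0 < k"
  shows "((\<lambda>u. binomial_tail u (j + k) k) has_real_derivative 
      (real (j + k) * real (j + k - 1 choose (k - 1))) * (u ^ (k - 1) * (1 - u) ^ j)) (at u)"
proof -
  obtain l where k: "k = Suc l" using assms by (cases k) auto
  have "(\<lambda>i. of_bool (Suc l \<le> Suc i) - of_bool (Suc l \<le> i) :: real) = (\<lambda>i. of_bool (i = l))"
    by auto
  moreover have "binomial_mean u (j + l) (\<lambda>i. of_bool (i = l)) 
      = real (j + l choose l) * (u ^ l * (1 - u) ^ j)"
    by (simp add: binomial_mean_def of_bool_def if_distrib[of "\<lambda>x. x * _"] cong: if_cong)
  ultimately show ?thesis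
    using has_real_derivative_binomial_mean[of "j + l" "\<lambda>i. of_bool (k \<le> i)" u]
    by (simp add: k binomial_tail_def mult.assoc)
qed

text \<open>If a walk \<open>S\<close> has independent Bernoulli steps \<open>\<xi>\<close>, the excess \<open>(S\<^sub>N - k)\<^sup>+\<close> grows by \<open>\<xi>\<close> exactly
  when \<open>S\<^sub>N \<ge> k\<close>; summing the expected increments over \<open>N\<close> gives a closed form.\<close>

lemma sum_binomial_tail:
  "u * (\<Sum>N<n. binomial_tail u N k) = binomial_mean u n (\<lambda>i. real (i - k))"
proof (induction n)
  case (Suc n)
  have "binomial_mean u (Suc n) (\<lambda>i. real (i - k)) 
    = binomial_mean u n (\<lambda>i. u * real (Suc i - k) + (1 - u) * real (i - k))"
    by (simp add: binomial_mean_Suc binomial_mean_add binomial_mean_cmult)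
  also have "(\<lambda>i. u * real (Suc i - k) + (1 - u) * real (i - k)) 
      = (\<lambda>i. real (i - k) + u * of_bool (k \<le> i))"
    by (auto simp: fun_eq_iff algebra_simps Suc_diff_le)
  finally show ?case using Suc
    by (simp add: binomial_mean_add binomial_mean_cmult binomial_tail_def algebra_simps)
qed simp

text \<open>A union bound over sets of \<open>k\<close> successes: the indicator of
  \<open>k <= i\<close> is at most \<open>i choose k\<close>, whose mean is computed exactly by
  induction.\<close>

lemma binomial_tail_le:
  assumes "0 \<le> u" "u \<le> 1"
  shows "binomial_tail u n k \<le> real (n choose k) * u ^ k"
proof -
  have "binomial_mean u n (\<lambda>i. real (i choose k)) = real (n choose k) * u ^ k" for n
  proof (induction n arbitrary: k)
    case 0
    show ?case by (cases k) auto
  next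
    case (Suc n)
    show ?case
    proof (cases k)
      case 0
      then show ?thesis by (simp add: binomial_mean_const)
    next
      case (Suc l)
      then show ?thesis
        by (simp add: binomial_mean_Suc binomial_mean_add Suc.IH algebra_simps)
    qed
  qed
  moreover have "binomial_tail u n k \<le> binomial_mean u n (\<lambda>i. real (i choose k))"
    unfolding binomial_tail_def using assms 
    by (intro binomial_mean_mono) (auto simp: Suc_le_eq of_bool_def)
  ultimately show ?thesis by simp
qed

text \<open>Keeps only the atom at \<open>k + 1\<close>. Subtraction of naturals truncates at zero,
  so \<open>real (i - k)\<close> is the positive part, with value 1 at this atom.\<close>

lemma binomial_excess_ge:
  assumes "0 \<le> u" "u \<le> 1" "k < n"
  shows "real (n choose Suc k) * u ^ Suc k * (1 - u) ^ (n - Suc k) \<le> binomial_mean u n (\<lambda>i. real (i - k))"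
proof -
  have "real (Suc k - k) * (real (n choose Suc k) * u ^ Suc k * (1 - u) ^ (n - Suc k)) \<le> binomial_mean u n (\<lambda>i. real (i - k))"
    unfolding binomial_mean_def 
    by (rule member_le_sum[where f = "\<lambda>i. real (i - k) * (real (n choose i) * u ^ i * (1 - u) ^ (n - i))"]) 
      (use assms in auto)
  then show ?thesis by simp
qed

text \<open>From \<open>k\<close> on, consecutive binomial probabilities have ratio at most
  \<open>r\<close>, so the atoms after \<open>k + 1\<close> are dominated by a geometric sequence.
  Weighting its terms by 1, 2, 3, ... produces the square in the denominator.\<close>

lemma binomial_excess_le:
  assumes "0 \<le> u" "u < 1" "k < n" and r: "real n * u / (real k * (1 - u)) \<le> r" "r < 1" and "0 < k"
  shows "binomial_mean u n (\<lambda>i. real (i - k)) 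
    \<le> real (n choose Suc k) * u ^ Suc k * (1 - u) ^ (n - Suc k) / (1 - r)\<^sup>2"
proof -
  define b where "b i = real (n choose i) * u ^ i * (1 - u) ^ (n - i)" for i
  have b0: "b i \<ge> 0" for i using assms by (simp add: b_def)
  have r0: "r \<ge> 0" using r(1) assms by (smt (verit) divide_nonneg_nonneg mult_nonneg_nonneg of_nat_0_le_iff)
  have step: "b (Suc i) \<le> b i * r" if "k \<le> i" for i
  proof (cases "i < n")
    case True
    have "real (Suc i) * real (n choose Suc i) = real (n - i) * real (n choose i)"
      using True by (metis binomial_absorb_comp binomial_absorption of_nat_mult)
    then have c: "real (n choose Suc i) = real (n - i) / real (Suc i) * real (n choose i)"
      by (simp add: field_simps)
    have "(1 - u) ^ (n - i) = (1 - u) * (1 - u) ^ (n - Suc i)"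
      using True by (metis Suc_diff_Suc power_Suc)
    then have "b (Suc i) = b i * (real (n - i) * u / (real (Suc i) * (1 - u)))"
      using assms by (simp add: b_def c)
    also have "\<dots> \<le> b i * r"
    proof (rule mult_left_mono[OF order_trans[OF _ r(1)] b0])
      \<comment> \<open>The exact ratio only improves as \<open>i\<close> grows; its numerator is
        enlarged to \<open>n * u\<close> and its denominator reduced to
        \<open>k * (1 - u)\<close>.\<close>
      show "real (n - i) * u / (real (Suc i) * (1 - u)) \<le> real n * u / (real k * (1 - u))"
        using assms that by (intro frac_le mult_right_mono mult_pos_pos mult_nonneg_nonneg) auto
    qed
    finally show ?thesis .
  next
    case False
    then have "b (Suc i) = 0" by (simp add: b_def)
    with b0[of i] r0 show ?thesis by simp
  qed
  have geom: "b (Suc k + l) \<le> b (Suc k) * r ^ l" for l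
  proof (induction l)
    case (Suc l)
    have "b (Suc k + Suc l) \<le> b (Suc k + l) * r" using step[of "Suc k + l"] by simp
    also have "\<dots> \<le> b (Suc k) * r ^ l * r" using Suc r0 by (rule mult_right_mono)
    finally show ?case by (simp add: mult_ac)
  qed simp
  have "binomial_mean u n (\<lambda>i. real (i - k)) = (\<Sum>i\<in>{Suc k..n}. real (i - k) * b i)"
    unfolding binomial_mean_def b_def by (intro sum.mono_neutral_right) auto
  also have "\<dots> = (\<Sum>l<n - k. real (Suc l) * b (Suc k + l))"
    by (rule sum.reindex_bij_witness[of _ "\<lambda>l. Suc k + l" "\<lambda>i. i - Suc k"]) auto
  also have "\<dots> \<le> (\<Sum>l<n - k. real (Suc l) * (b (Suc k) * r ^ l))"
    by (intro sum_mono mult_left_mono geom) auto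
  also have "\<dots> = b (Suc k) * (\<Sum>l<n - k. real (Suc l) * r ^ l)"
    by (simp add: sum_distrib_left mult_ac)
  also have "\<dots> \<le> b (Suc k) * (1 / (1 - r)\<^sup>2)"
  proof (rule mult_left_mono[OF _ b0])
    have "(\<lambda>l. real (Suc l) * r ^ l) sums (1 / (1 - r)\<^sup>2)"
      using geometric_deriv_sums[of r] r0 r by simp
    then show "(\<Sum>l<n - k. real (Suc l) * r ^ l) \<le> 1 / (1 - r)\<^sup>2"
      using r0 sum_le_suminf[of "\<lambda>l. real (Suc l) * r ^ l" "{..<n - k}"] by (simp add: sums_iff)
  qed
  finally show ?thesis by (simp add: b_def)
qed

section \<open>Distribution function of the largest modulus\<close>

text \<open>With \<open>u = 1 - s\<close> the derivative of the binomial tail becomes the Beta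
  density with parameters \<open>j + 1\<close> and \<open>k\<close>. At \<open>s = 0\<close> the
  success probability is 1 and so is the tail, which gives the constant term.\<close>

lemma beta_integral_eq_binomial_tail:
  assumes "0 < k" "0 \<le> t"
  shows "(real (j + k) * real (j + k - 1 choose (k - 1))) * 
      (\<integral>s. indicator {0..t} s * (s ^ j * (1 - s) ^ (k - 1)) \<partial>lborel) = 1 - binomial_tail (1 - t) (j + k) k"
proof -
  define c where "c = real (j + k) * real (j + k - 1 choose (k - 1))"
  have "(\<integral>s. c * (s ^ j * (1 - s) ^ (k - 1)) * indicator {0..t} s \<partial>lborel) 
      = - binomial_tail (1 - t) (j + k) k - - binomial_tail (1 - 0) (j + k) k"
  proof (rule integral_FTC_Icc_real)
    show "((\<lambda>s. - binomial_tail (1 - s) (j + k) k) has_real_derivative c * (s ^ j * (1 - s) ^ (k - 1))) (at s)" for s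
      unfolding c_def 
      by (rule derivative_eq_intros DERIV_chain2[OF has_real_derivative_binomial_tail] assms refl)+ simp
  qed (use assms in auto)
  moreover have "(\<integral>s. c * (s ^ j * (1 - s) ^ (k - 1)) * indicator {0..t} s \<partial>lborel) 
      = c * (\<integral>s. indicator {0..t} s * (s ^ j * (1 - s) ^ (k - 1)) \<partial>lborel)"
    by (subst integral_mult_right_zero[symmetric]) (simp only: mult_ac)
  ultimately show ?thesis
    unfolding c_def[symmetric] by (simp add: binomial_tail_1)
qed

text \<open>Absorbs both the disc condition and the cut-off at \<open>r\<close> into a one-variable
  weight, so that the product structure survives. The maximum with 0 reflects that
  \<open>ennreal\<close> sends negative reals to 0.\<close>

lemma truncated_eigenvalue_density_eq:
  assumes g_def: "\<And>s. g s = (if s < 1 \<and> s \<le> r\<^sup>2 then (1 - s) ^ (n - m - 1) else 0)" and "0 \<le> r"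
  shows "truncated_eigenvalue_density n m C z * of_bool (\<forall>j<m. cmod (z j) \<le> r)
    = ennreal (max C 0 * (\<Prod>k<m. \<Prod>j<k. (cmod (z j - z k))\<^sup>2) * (\<Prod>j<m. g ((cmod (z j))\<^sup>2)))"
proof (cases "(\<forall>j<m. cmod (z j) < 1) \<and> (\<forall>j<m. cmod (z j) \<le> r)")
  case True
  define W where "W = (\<Prod>k<m. \<Prod>j<k. (cmod (z j - z k))\<^sup>2) * (\<Prod>j<m. (1 - (cmod (z j))\<^sup>2) ^ (n - m - 1))"
  have sq: "(cmod (z j))\<^sup>2 < 1 \<and> (cmod (z j))\<^sup>2 \<le> r\<^sup>2" if "j < m" for j
    using True that by (auto simp: abs_square_less_1 intro!: power_mono)
  have W0: "0 \<le> W"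
    unfolding W_def by (intro mult_nonneg_nonneg prod_nonneg) (use sq in \<open>auto simp: less_imp_le\<close>)
  have "(\<Prod>j<m. g ((cmod (z j))\<^sup>2)) = (\<Prod>j<m. (1 - (cmod (z j))\<^sup>2) ^ (n - m - 1))"
    by (intro prod.cong refl) (use sq in \<open>auto simp: g_def\<close>)
  moreover have "ennreal (C * W) = ennreal (max C 0 * W)"
    using W0 by (cases "C \<ge> 0") (auto simp: max_def ennreal_neg mult_nonpos_nonneg)
  ultimately show ?thesis
    using True by (simp add: truncated_eigenvalue_density_def W_def mult.assoc)
next
  case False
  then obtain j where j: "j < m" "\<not> (cmod (z j) < 1 \<and> cmod (z j) \<le> r)" by blast
  have "(cmod (z j))\<^sup>2 < 1 \<longleftrightarrow> cmod (z j) < 1" "(cmod (z j))\<^sup>2 \<le> r\<^sup>2 \<longleftrightarrow> cmod (z j) \<le> r"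
    using assms by (simp_all add: abs_square_less_1 power2_le_iff_abs_le)
  with j have "g ((cmod (z j))\<^sup>2) = 0" by (auto simp: g_def)
  with j(1) have "(\<Prod>j<m. g ((cmod (z j))\<^sup>2)) = 0" by (intro prod_zero) auto
  moreover have "truncated_eigenvalue_density n m C z * of_bool (\<forall>j<m. cmod (z j) \<le> r) = 0"
    using False by (auto simp: truncated_eigenvalue_density_def)
  ultimately show ?thesis by (simp only: mult_zero_right ennreal_0)
qed

text \<open>The probability is the integral with cut-off \<open>r\<close>. Dividing it by the total
  mass, which is 1, eliminates the normalizing constant and leaves a product of Beta distribution
  functions.\<close>

lemma prob_all_cmod_le:
  fixes z :: "nat \<Rightarrow> 'w \<Rightarrow> complex"
  assumes "prob_space M" "m < n" "0 \<le> r" "r < 1"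
    and dist: "distributed M (Pi\<^sub>M {..<m} (\<lambda>_. lborel)) (\<lambda>\<omega>. \<lambda>j\<in>{..<m}. z j \<omega>)
             (truncated_eigenvalue_density n m C)"
  shows "measure M {\<omega> \<in> space M. \<forall>j<m. cmod (z j \<omega>) \<le> r} 
    = (\<Prod>j<m. 1 - binomial_tail (1 - r\<^sup>2) (j + (n - m)) (n - m))"
proof -
  interpret prob_space M by fact
  define k where "k = n - m"
  have k: "0 < k" using assms by (simp add: k_def)
  let ?P = "Pi\<^sub>M {..<m} (\<lambda>_. lborel :: complex measure)"
  define D where "D = truncated_eigenvalue_density n m C"
  define g where "g r s = (if s < 1 \<and> s \<le> r\<^sup>2 then (1 - s) ^ (k - 1) else (0 :: real))" for r s
  have [measurable]: "g r \<in> borel_measurable borel" for r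
    unfolding g_def by measurable
  define I where "I r j = (\<integral>s. indicator {0..r\<^sup>2} s * (s ^ j * (1 - s) ^ (k - 1)) \<partial>lborel)" for r :: real and j
  have I_eq: "(\<integral>s. indicator {0..} s * (s ^ j * g r s) \<partial>lborel) = I r j" if "0 \<le> r" "r \<le> 1" for r j
    unfolding I_def
  proof (rule integral_cong_AE)
    have "r\<^sup>2 \<le> 1" using that by (simp add: power_le_one)
    show "AE s in lborel. indicator {0..} s * (s ^ j * g r s) = indicator {0..r\<^sup>2} s * (s ^ j * (1 - s) ^ (k - 1))"
      \<comment> \<open>At \<open>s = 1\<close> the integrands can disagree: for
        \<open>k = 1\<close> and \<open>r = 1\<close> the power \<open>0 ^ 0\<close> is 1, whereas
        \<open>g\<close> is 0 there.\<close>
      using AE_lborel_singleton[of "1 :: real"]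
      by eventually_elim (use \<open>r\<^sup>2 \<le> 1\<close> in \<open>auto simp: g_def indicator_def\<close>)
  qed measurable
  define K where "K r = max C 0 * fact m * (\<Prod>j<m. pi * I r j)" for r
  have int: "(\<integral>\<^sup>+z. D z * of_bool (\<forall>j<m. cmod (z j) \<le> r) \<partial>?P) = ennreal (K r)" if "0 \<le> r" "r \<le> 1" for r
  proof -
    have "(\<integral>\<^sup>+z. D z * of_bool (\<forall>j<m. cmod (z j) \<le> r) \<partial>?P) = 
      (\<integral>\<^sup>+z. ennreal (max C 0 * (\<Prod>k<m. \<Prod>j<k. (cmod (z j - z k))\<^sup>2) * (\<Prod>j<m. g r ((cmod (z j))\<^sup>2))) \<partial>?P)"
      unfolding D_def by (subst truncated_eigenvalue_density_eq[OF _ that(1)]) (auto simp: g_def k_def)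
    also have "\<dots> = ennreal (max C 0 * fact m * (\<Prod>j<m. pi * (\<integral>s. indicator {0..} s * (s ^ j * g r s) \<partial>lborel)))"
      by (rule nn_integral_vandermonde_radial) (auto simp: g_def power_le_one)
    finally show ?thesis by (simp only: K_def I_eq[OF that])
  qed
  have I0: "0 \<le> I r j" if "0 \<le> r" "r \<le> 1" for r j
    unfolding I_eq[OF that, symmetric] by (rule Bochner_Integration.integral_nonneg) (auto simp: g_def indicator_def)
  then have K0: "0 \<le> K r" if "0 \<le> r" "r \<le> 1" for r
    using that unfolding K_def by (intro mult_nonneg_nonneg prod_nonneg) auto
  let ?X = "\<lambda>\<omega>. \<lambda>j\<in>{..<m}. z j \<omega>"
  have X: "?X \<in> measurable M ?P" using dist by (rule distributed_measurable)
  have "ennreal (K 1) = 1"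
  proof -
    have "emeasure M (?X -` space ?P \<inter> space M) = (\<integral>\<^sup>+z. D z * indicator (space ?P) z \<partial>?P)"
      unfolding D_def by (rule distributed_emeasure[OF dist]) auto
    \<comment> \<open>A cut-off at 1 removes nothing, since the density already vanishes off the
      open disc.\<close>
    also have "\<dots> = (\<integral>\<^sup>+z. D z * of_bool (\<forall>j<m. cmod (z j) \<le> 1) \<partial>?P)"
      by (intro nn_integral_cong)
        (auto simp: D_def truncated_eigenvalue_density_def of_bool_def intro: less_imp_le)
    also have "\<dots> = ennreal (K 1)" by (rule int) auto
    also have "?X -` space ?P \<inter> space M = space M" using measurable_space[OF X] by auto
    finally show ?thesis by (simp add: emeasure_space_1)
  qed
  then have K1: "K 1 = 1" using K0[of 1] by (simp add: ennreal_eq_1)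
  have I1: "I 1 j \<noteq> 0" if "j < m" for j
  proof
    assume "I 1 j = 0"
    then have "(\<Prod>j<m. pi * I 1 j) = 0" using that by (intro prod_zero) auto
    then have "K 1 = 0" by (simp only: K_def mult_zero_right)
    with K1 show False by simp
  qed
  define S where "S = {x \<in> space ?P. \<forall>j<m. cmod (x j) \<le> r}"
  have S[measurable]: "S \<in> sets ?P" unfolding S_def by measurable
  have "emeasure M (?X -` S \<inter> space M) = (\<integral>\<^sup>+z. D z * indicator S z \<partial>?P)"
    unfolding D_def by (rule distributed_emeasure[OF dist S])
  also have "\<dots> = (\<integral>\<^sup>+z. D z * of_bool (\<forall>j<m. cmod (z j) \<le> r) \<partial>?P)"
    by (intro nn_integral_cong) (auto simp: S_def indicator_def)
  also have "\<dots> = ennreal (K r)" using assms by (intro int) auto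
  also have "?X -` S \<inter> space M = {\<omega> \<in> space M. \<forall>j<m. cmod (z j \<omega>) \<le> r}"
    using measurable_space[OF X] by (auto simp: S_def)
  finally have "measure M {\<omega> \<in> space M. \<forall>j<m. cmod (z j \<omega>) \<le> r} = K r"
    using K0[of r] assms by (simp add: measure_def)
  \<comment> \<open>In the quotient the factors \<open>max C 0\<close>, \<open>fact m\<close> and
    the powers of \<open>pi\<close> cancel; they are nonzero because \<open>K 1\<close> is.\<close>
  also have "\<dots> = K r / K 1" by (simp add: K1)
  also have "\<dots> = (\<Prod>j<m. I r j / I 1 j)"
    using K1 by (simp add: K_def prod_dividef prod.distrib)
  also have "\<dots> = (\<Prod>j<m. 1 - binomial_tail (1 - r\<^sup>2) (j + k) k)"
  proof (intro prod.cong refl)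
    fix j assume "j \<in> {..<m}"
    define c where "c = real (j + k) * real (j + k - 1 choose (k - 1))"
    have "c * I r j = 1 - binomial_tail (1 - r\<^sup>2) (j + k) k" "c * I 1 j = 1 - binomial_tail (1 - 1\<^sup>2) (j + k) k"
      unfolding c_def I_def by (intro beta_integral_eq_binomial_tail k zero_le_power2)+
    \<comment> \<open>At cut-off 1 the success probability is 0 and the tail vanishes, so
      \<open>c\<close> is the reciprocal of \<open>I 1 j\<close>.\<close>
    moreover have "binomial_tail 0 (j + k) k \<le> 0"
      using binomial_tail_le[of 0 "j + k" k] k by (simp add: zero_power)
    ultimately have *: "c * I r j = 1 - binomial_tail (1 - r\<^sup>2) (j + k) k" "c * I 1 j = 1"
      using binomial_tail_bounds(1)[of 0 "j + k" k] by auto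
    have "c \<noteq> 0" using *(2) by auto
    then have "I r j / I 1 j = (c * I r j) / (c * I 1 j)" by simp
    also have "\<dots> = 1 - binomial_tail (1 - r\<^sup>2) (j + k) k" unfolding * by simp
    finally show "I r j / I 1 j = 1 - binomial_tail (1 - r\<^sup>2) (j + k) k" .
  qed
  finally show ?thesis by (simp add: k_def)
qed

subsection \<open>Asymptotics\<close>

text \<open>For the lower bound \<open>exp (- t)\<close> is replaced by its minimum
  \<open>exp (- a)\<close>. For the upper bound, the integrand times \<open>K - t\<close> is the
  derivative of \<open>t ^ K * exp (- t)\<close>, and \<open>K - t\<close> is at least
  \<open>K - a\<close> on the interval.\<close>

lemma lower_gamma_bounds:
  fixes a :: real
  assumes K: "0 < K" and "0 \<le> a"
  shows "a ^ K * exp (- a) / real K \<le> integral {0..a} (\<lambda>t. t ^ (K - 1) * exp (- t))"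
    and "a < real K \<Longrightarrow> integral {0..a} (\<lambda>t. t ^ (K - 1) * exp (- t)) \<le> a ^ K * exp (- a) / (real K - a)"
proof -
  have int: "((\<lambda>t. t ^ (K - 1) * exp (- t)) has_integral integral {0..a} (\<lambda>t. t ^ (K - 1) * exp (- t))) {0..a}"
    by (intro integrable_integral integrable_continuous_interval continuous_intros)
  have "((\<lambda>t. t ^ (K - 1) * exp (- a)) has_integral (a ^ K / real K * exp (- a) - 0 ^ K / real K * exp (- a))) {0..a}"
    by (rule fundamental_theorem_of_calculus) 
      (use assms in \<open>auto intro!: derivative_eq_intros simp flip: has_real_derivative_iff_has_vector_derivative\<close>)
  moreover have "t ^ (K - 1) * exp (- a) \<le> t ^ (K - 1) * exp (- t)" if "t \<in> {0..a}" for t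
    using that by (intro mult_left_mono) auto
  ultimately have "a ^ K / real K * exp (- a) - 0 ^ K / real K * exp (- a) \<le> integral {0..a} (\<lambda>t. t ^ (K - 1) * exp (- t))"
    by (rule has_integral_le[OF _ int])
  then
  show "a ^ K * exp (- a) / real K \<le> integral {0..a} (\<lambda>t. t ^ (K - 1) * exp (- t))"
    using K by (simp add: zero_power)
  assume a: "a < real K"
  have "((\<lambda>t. (real K - t) * (t ^ (K - 1) * exp (- t))) has_integral (a ^ K * exp (- a) - 0 ^ K * exp (- 0))) {0..a}"
  proof (rule fundamental_theorem_of_calculus)
    fix t :: real
    have "t ^ K = t * t ^ (K - 1)" using K by (simp add: power_eq_if)
    then show "((\<lambda>t. t ^ K * exp (- t)) has_vector_derivative (real K - t) * (t ^ (K - 1) * exp (- t))) (at t within {0..a})"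
      by (auto intro!: derivative_eq_intros simp: algebra_simps simp flip: has_real_derivative_iff_has_vector_derivative)
  qed (use assms in auto)
  from has_integral_le[OF has_integral_mult_right[OF int, of "real K - a"] this]
  have "(real K - a) * integral {0..a} (\<lambda>t. t ^ (K - 1) * exp (- t)) \<le> a ^ K * exp (- a)"
    using K by (simp add: zero_power mult_right_mono)
  then show "integral {0..a} (\<lambda>t. t ^ (K - 1) * exp (- t)) \<le> a ^ K * exp (- a) / (real K - a)"
    using a by (simp add: field_simps)
qed

text \<open>Replacing \<open>ln (1 + w)\<close> by \<open>w\<close> costs at most
  \<open>2 * w^2\<close> for small \<open>w\<close>, which stays negligible after multiplication by
  \<open>m\<close>. The term \<open>c\<close> is a compensator: only its sum with
  \<open>m * w\<close> has to converge.\<close>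

lemma tendsto_power_exp:
  fixes w c :: "nat \<Rightarrow> real" and m :: "nat \<Rightarrow> nat"
  assumes "w \<longlonglongrightarrow> 0" "(\<lambda>n. real (m n) * (w n)\<^sup>2) \<longlonglongrightarrow> 0" "(\<lambda>n. real (m n) * w n + c n) \<longlonglongrightarrow> l"
  shows "(\<lambda>n. (1 + w n) ^ m n * exp (c n)) \<longlonglongrightarrow> exp l"
proof -
  have small: "\<forall>\<^sub>F n in sequentially. \<bar>w n\<bar> \<le> 1 / 2"
    using tendsto_rabs[OF assms(1)] by (intro eventually_mono[OF order_tendstoD(2)[of _ 0 _ "1/2"]]) auto
  have "(\<lambda>n. real (m n) * (ln (1 + w n) - w n)) \<longlonglongrightarrow> 0"
  proof (rule Lim_null_comparison)
    show "(\<lambda>n. 2 * (real (m n) * (w n)\<^sup>2)) \<longlonglongrightarrow> 0"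
      using tendsto_mult_left[OF assms(2), of 2] by simp
    show "\<forall>\<^sub>F n in sequentially. norm (real (m n) * (ln (1 + w n) - w n)) \<le> 2 * (real (m n) * (w n)\<^sup>2)"
      using small
    proof eventually_elim
      case (elim n)
      have "real (m n) * \<bar>ln (1 + w n) - w n\<bar> \<le> real (m n) * (2 * (w n)\<^sup>2)"
        by (intro mult_left_mono abs_ln_one_plus_x_minus_x_bound elim) auto
      then show ?case by (simp add: abs_mult)
    qed
  qed
  from tendsto_exp[OF tendsto_add[OF this assms(3)]]
  have "(\<lambda>n. exp (real (m n) * ln (1 + w n) + c n)) \<longlonglongrightarrow> exp l"
    by (simp add: algebra_simps)
  moreover have "\<forall>\<^sub>F n in sequentially. exp (real (m n) * ln (1 + w n) + c n) = (1 + w n) ^ m n * exp (c n)"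
    using small by eventually_elim (auto simp: exp_add exp_of_nat_mult)
  ultimately show ?thesis by (rule Lim_transform_eventually)
qed

text \<open>Each factor differs from \<open>exp (- q)\<close> by at most \<open>q * q\<close>, and a
  product of numbers in the unit interval changes by at most the sum of the changes of its factors.
  Uniform smallness bounds that sum by \<open>d n\<close> times a convergent sequence.\<close>

lemma tendsto_prod_one_minus:
  fixes q :: "nat \<Rightarrow> nat \<Rightarrow> real"
  assumes q: "\<forall>\<^sub>F n in sequentially. \<forall>j<m n. 0 \<le> q n j \<and> q n j \<le> 1 \<and> q n j \<le> d n"
    and "d \<longlonglongrightarrow> 0" and S: "(\<lambda>n. \<Sum>j<m n. q n j) \<longlonglongrightarrow> l"
  shows "(\<lambda>n. \<Prod>j<m n. 1 - q n j) \<longlonglongrightarrow> exp (- l)"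
proof -
  have quad: "\<bar>1 - s - exp (- s)\<bar> \<le> s * s" if "0 \<le> s" for s :: real
  proof -
    have "exp (- s) \<ge> 1 - s" using exp_ge_add_one_self[of "- s"] by simp
    moreover have "exp (- s) \<le> 1 - s + s * s"
    proof -
      \<comment> \<open>The right-hand side equals \<open>1 + s^3\<close>; then \<open>1 + s\<close>
        is bounded by \<open>exp s\<close>.\<close>
      have "1 \<le> (1 - s + s * s) * (1 + s)" using that by (simp add: algebra_simps)
      also have "\<dots> \<le> (1 - s + s * s) * exp s"
      proof (intro mult_left_mono)
        have "1 - s + s * s = (1 - s)\<^sup>2 + s" by (simp add: power2_eq_square algebra_simps)
        then show "0 \<le> 1 - s + s * s" using that zero_le_power2[of "1 - s"] by linarith
      qed (use exp_ge_add_one_self[of s] in simp)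
      finally show ?thesis by (simp add: exp_minus field_simps)
    qed
    ultimately show ?thesis by simp
  qed
  have "(\<lambda>n. (\<Prod>j<m n. 1 - q n j) - (\<Prod>j<m n. exp (- q n j))) \<longlonglongrightarrow> 0"
  proof (rule Lim_null_comparison)
    show "(\<lambda>n. d n * (\<Sum>j<m n. q n j)) \<longlonglongrightarrow> 0"
      using tendsto_mult[OF assms(2) S] by simp
    show "\<forall>\<^sub>F n in sequentially. norm ((\<Prod>j<m n. 1 - q n j) - (\<Prod>j<m n. exp (- q n j))) \<le> d n * (\<Sum>j<m n. q n j)"
      using q
    proof eventually_elim
      case (elim n)
      have "norm ((\<Prod>j<m n. 1 - q n j) - (\<Prod>j<m n. exp (- q n j))) \<le> (\<Sum>j<m n. norm (1 - q n j - exp (- q n j)))"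
        by (rule norm_prod_diff) (use elim in auto)
      also have "\<dots> \<le> (\<Sum>j<m n. d n * q n j)"
      proof (rule sum_mono)
        fix j assume "j \<in> {..<m n}"
        then have j: "0 \<le> q n j" "q n j \<le> d n" using elim by auto
        have "norm (1 - q n j - exp (- q n j)) \<le> q n j * q n j" using quad[OF j(1)] by simp
        also have "\<dots> \<le> d n * q n j" using j by (intro mult_right_mono)
        finally show "norm (1 - q n j - exp (- q n j)) \<le> d n * q n j" .
      qed
      finally show ?case by (simp add: sum_distrib_left)
    qed
  qed
  moreover have "(\<lambda>n. \<Prod>j<m n. exp (- q n j)) \<longlonglongrightarrow> exp (- l)"
    using tendsto_exp[OF tendsto_minus[OF S]] by (simp add: exp_sum[symmetric] sum_negf)
  ultimately show ?thesis by (rule Lim_transform[rotated])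
qed

text \<open>The ratio is the product of the factors \<open>1 - i / n\<close> for
  \<open>i < K\<close>. Each lies between \<open>1 - K / n\<close> and 1, and Bernoulli's inequality
  bounds the resulting power from below.\<close>

lemma binomial_falling_ratio:
  assumes "K \<le> n" "0 < n"
  shows "real (n choose K) * fact K / real n ^ K \<le> 1"
    and "1 - (real K)\<^sup>2 / real n \<le> real (n choose K) * fact K / real n ^ K"
proof -
  have "real (n choose K) * fact K = (\<Prod>i = 0..<K. real n - real i)"
    using gbinomial_mult_fact'[of "real n" K] by (simp add: binomial_gbinomial)
  also have "\<dots> = (\<Prod>i = 0..<K. real n * (1 - real i / real n))"
    using assms by (intro prod.cong) (auto simp: field_simps)
  finally have eq: "real (n choose K) * fact K / real n ^ K = (\<Prod>i = 0..<K. 1 - real i / real n)"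
    using assms by (simp add: prod.distrib)
  show "real (n choose K) * fact K / real n ^ K \<le> 1"
    unfolding eq using assms by (intro prod_le_1) (auto simp: field_simps)
  have "1 - (real K)\<^sup>2 / real n = 1 + real K * (- (real K / real n))"
    by (simp add: power2_eq_square)
  also have "\<dots> \<le> (1 + - (real K / real n)) ^ K"
    using assms by (intro Bernoulli_inequality) (auto simp: field_simps)
  also have "\<dots> = (\<Prod>i = 0..<K. 1 - real K / real n)" by simp
  also have "\<dots> \<le> (\<Prod>i = 0..<K. 1 - real i / real n)"
    using assms by (intro prod_mono) (auto simp: field_simps)
  finally show "1 - (real K)\<^sup>2 / real n \<le> real (n choose K) * fact K / real n ^ K"
    unfolding eq .
qed

lemma sum_shifted_binomial_tail:
  assumes "k \<le> n"
  shows "u * (\<Sum>j<n - k. binomial_tail u (j + k) k) = binomial_mean u n (\<lambda>i. real (i - k))"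
proof -
  have "(\<Sum>N<n. binomial_tail u N k) = (\<Sum>N\<in>{k..<n}. binomial_tail u N k)"
    by (intro sum.mono_neutral_right) (auto simp: binomial_tail_eq_0)
  also have "\<dots> = (\<Sum>j<n - k. binomial_tail u (j + k) k)"
    by (rule sum.reindex_bij_witness[of _ "\<lambda>j. j + k" "\<lambda>N. N - k"]) auto
  finally show ?thesis by (metis sum_binomial_tail)
qed

section \<open>Asymptotics of the centring sequence\<close>

locale gumbel_scaling =
  fixes k :: "nat \<Rightarrow> nat" and a :: "nat \<Rightarrow> real"
  assumes k_range: "\<And>n. n \<ge> 2 \<Longrightarrow> 0 < k n \<and> k n < n"
    and k_at_top: "filterlim k at_top sequentially"
    and k_over_log: "(\<lambda>n. real (k n) / ln (real n)) \<longlonglongrightarrow> 0"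
    and a_pos: "\<And>n. n \<ge> 2 \<Longrightarrow> a n > 0"
    and a_eq: "\<And>n. n \<ge> 2 \<Longrightarrow>
           1 / fact (k n - 1) * integral {0..a n} (\<lambda>t. t ^ (k n - 1) * exp (- t))
             = real (k n) / real n"
begin

lemma eventually_ge_2: "\<forall>\<^sub>F n in sequentially. n \<ge> (2::nat)"
  by (rule eventually_ge_at_top)

text \<open>The Poisson probability of the value \<open>k n\<close> at mean \<open>a n\<close>. The
  normalized incomplete Gamma integral defining \<open>a n\<close> is the Poisson tail from
  \<open>k n\<close> on, of which this is the first term.\<close>

definition weight :: "nat \<Rightarrow> real" where
  "weight n = a n ^ k n * exp (- a n) / fact (k n)"

lemma fact_k: "n \<ge> 2 \<Longrightarrow> (fact (k n) :: real) = real (k n) * fact (k n - 1)"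
  using k_range[of n] by (simp add: fact_reduce)

lemma weight_le: "n \<ge> 2 \<Longrightarrow> weight n \<le> real (k n) / real n"
  using lower_gamma_bounds(1)[of "k n" "a n"] k_range[of n] a_pos[of n]
  by (simp add: weight_def fact_k flip: a_eq) (simp add: field_simps)

lemma weight_ge:
  assumes "n \<ge> 2" "a n < real (k n)"
  shows "real (k n) / real n * (1 - a n / real (k n)) \<le> weight n"
proof -
  have k: "real (k n) > 0" using k_range[OF assms(1)] by simp
  have "real (k n) / real n \<le> 1 / fact (k n - 1) * (a n ^ k n * exp (- a n) / (real (k n) - a n))"
    unfolding a_eq[OF assms(1), symmetric]
    using lower_gamma_bounds(2)[of "k n" "a n"] k_range[of n] a_pos[of n] assms
    by (intro mult_left_mono) auto
  also have "\<dots> * (1 - a n / real (k n)) = weight n"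
    using assms k by (simp add: weight_def fact_k[OF assms(1)] field_simps)
  finally show ?thesis using assms k by (simp add: mult_right_mono)
qed

lemma eventually_k_le_log: 
  assumes "0 < c"
  shows "\<forall>\<^sub>F n in sequentially. real (k n) * c < ln (real n)"
proof -
  have "\<forall>\<^sub>F n in sequentially. real (k n) / ln (real n) < 1 / c"
    using order_tendstoD(2)[OF k_over_log, of "1 / c"] assms by simp
  with eventually_ge_2 show ?thesis
  proof eventually_elim
    case (elim n)
    then have "ln (real n) > 0" by simp
    with elim assms show ?case by (simp add: field_simps)
  qed
qed

text \<open>If \<open>a n\<close> were at least \<open>e * k n\<close>, the Gamma integral would
  exceed a quantity exponentially small in \<open>k n\<close> only. Being of size
  \<open>k n / n\<close>, it would force \<open>ln n\<close> to be bounded by a multiple of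
  \<open>k n\<close>.\<close>

lemma a_over_k: "(\<lambda>n. a n / real (k n)) \<longlonglongrightarrow> 0"
proof (rule order_tendstoI)
  show "\<forall>\<^sub>F n in sequentially. l < a n / real (k n)" if "l < 0" for l
    using eventually_ge_2
  proof eventually_elim
    case (elim n)
    have "0 < a n / real (k n)" using k_range[OF elim] a_pos[OF elim] by simp
    with that show ?case by simp
  qed
  fix e :: real assume "0 < e"
  \<comment> \<open>Minus the logarithm of \<open>e * exp (- e)\<close>, the exponential rate in the
    lower bound. The 1 added in \<open>c\<close> pays for the estimate of \<open>ln K\<close> by
    \<open>K\<close>.\<close>
  define d where "d = - (ln e - e)"
  define c where "c = 1 + max d 0"
  have "c > 0" by (simp add: c_def)
  show "\<forall>\<^sub>F n in sequentially. a n / real (k n) < e"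
    using eventually_ge_2 eventually_k_le_log[OF \<open>c > 0\<close>]
  proof eventually_elim
    case (elim n)
    define K where "K = k n"
    have K: "0 < K" "K < n" using k_range[OF elim(1)] by (auto simp: K_def)
    show ?case
    proof (rule ccontr)
      assume "\<not> ?thesis"
      then have "e * real K \<le> a n" using K by (simp add: K_def field_simps)
      define b where "b = e * real K"
      have b: "0 < b" "b \<le> a n" using \<open>0 < e\<close> K \<open>e * real K \<le> a n\<close> by (auto simp: b_def)
      have "b ^ K * exp (- b) / real K \<le> integral {0..b} (\<lambda>t. t ^ (K - 1) * exp (- t))"
        by (rule lower_gamma_bounds) (use b K in auto)
      also have "\<dots> \<le> integral {0..a n} (\<lambda>t. t ^ (K - 1) * exp (- t))"
        by (intro integral_subset_le integrable_continuous_interval continuous_intros) (use b in auto)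
      also have "\<dots> = fact (K - 1) * (real K / real n)"
        using a_eq[OF elim(1)] by (simp add: K_def field_simps)
      finally have "b ^ K * exp (- b) \<le> fact K * (real K / real n)"
        using K by (simp add: fact_k[OF elim(1)] K_def field_simps)
      \<comment> \<open>Chosen to cancel against the factor \<open>K ^ K\<close> contained in
        \<open>b ^ K\<close>.\<close>
      also have "\<dots> \<le> real K ^ K * (real K / real n)"
        using fact_le_power[of K, where 'a = real] by (intro mult_right_mono) simp_all
      finally have "real K ^ K * (e ^ K * exp (- b)) \<le> real K ^ K * (real K / real n)"
        by (simp add: b_def power_mult_distrib mult_ac)
      then have "e ^ K * exp (- b) \<le> real K / real n"
        using K by (subst (asm) mult_le_cancel_left_pos) auto
      then have "real n * (e ^ K * exp (- b)) \<le> real K"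
        using K by (simp add: field_simps)
      then have "ln (real n * (e ^ K * exp (- b))) \<le> ln (real K)"
        using K \<open>0 < e\<close> by (intro ln_mono) auto
      then have "ln (real n) + real K * ln e - b \<le> ln (real K)"
        using K \<open>0 < e\<close> by (simp add: ln_mult ln_realpow)
      also have "\<dots> \<le> real K"
        using K ln_le_minus_one[of "real K"] by simp
      finally have "ln (real n) \<le> real K * (1 + d)"
        by (simp add: b_def d_def algebra_simps)
      also have "\<dots> \<le> real K * c"
        by (intro mult_left_mono) (auto simp: c_def)
      finally show False using elim(2) by (simp add: K_def)
    qed
  qed
qed

lemma k_inf: "filterlim (\<lambda>n. real (k n)) at_top sequentially"
  using k_at_top by (rule filterlim_compose[OF filterlim_real_sequentially])

lemma inverse_k: "(\<lambda>n. 1 / real (k n)) \<longlonglongrightarrow> 0"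
  using tendsto_divide_0[OF tendsto_const filterlim_at_top_imp_at_infinity[OF k_inf]] .

lemma k_square_over_n: "(\<lambda>n. (real (k n))\<^sup>2 / real n) \<longlonglongrightarrow> 0"
proof (rule tendsto_sandwich[OF _ _ tendsto_const])
  show "(\<lambda>n. (ln (real n))\<^sup>2 / real n) \<longlonglongrightarrow> 0" by real_asymp
  show "\<forall>\<^sub>F n in sequentially. (real (k n))\<^sup>2 / real n \<le> (ln (real n))\<^sup>2 / real n"
    using eventually_k_le_log[of 1, simplified]
    by (rule eventually_mono) (auto intro!: divide_right_mono power_mono)
qed auto

text \<open>Eventually \<open>k n\<close> is below half of \<open>ln n\<close>, so
  \<open>exp (k n)\<close> is at most the square root of \<open>n\<close>.\<close>

lemma k_exp_k_over_n: "(\<lambda>n. real (k n) * exp (real (k n)) / real n) \<longlonglongrightarrow> 0"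
proof (rule tendsto_sandwich[OF _ _ tendsto_const])
  show "(\<lambda>n. ln (real n) * exp (ln (real n) / 2) / real n) \<longlonglongrightarrow> 0" by real_asymp
  show "\<forall>\<^sub>F n in sequentially. real (k n) * exp (real (k n)) / real n \<le> ln (real n) * exp (ln (real n) / 2) / real n"
    using eventually_ge_2 eventually_k_le_log[of 1, simplified] eventually_k_le_log[of 2, simplified]
    by eventually_elim (auto intro!: divide_right_mono mult_mono)
qed auto

lemma eventually_a_less_k: "\<forall>\<^sub>F n in sequentially. a n < real (k n)"
  using eventually_ge_2 order_tendstoD(2)[OF a_over_k, of 1, simplified]
  by eventually_elim (use k_range in \<open>auto simp: field_simps\<close>)

lemma a_over_n: "(\<lambda>n. a n / real n) \<longlonglongrightarrow> 0"
proof (rule tendsto_sandwich[OF _ _ tendsto_const k_square_over_n])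
  show "\<forall>\<^sub>F n in sequentially. 0 \<le> a n / real n"
    using eventually_ge_2 by eventually_elim (use a_pos in \<open>auto intro: less_imp_le\<close>)
  show "\<forall>\<^sub>F n in sequentially. a n / real n \<le> (real (k n))\<^sup>2 / real n"
    using eventually_ge_2 eventually_a_less_k
  proof eventually_elim
    case (elim n)
    have "real (k n) * 1 \<le> real (k n) * real (k n)"
      using k_range[OF elim(1)] by (intro mult_left_mono) auto
    with elim show ?case by (intro divide_right_mono) (auto simp: power2_eq_square)
  qed
qed

text \<open>The two Gamma bounds confine the ratio between \<open>1 - a n / k n\<close> and 1, and
  \<open>a n / k n\<close> tends to 0.\<close>

lemma weight_ratio: "(\<lambda>n. weight n * real n / real (k n)) \<longlonglongrightarrow> 1"
proof (rule tendsto_sandwich)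
  show "(\<lambda>n. 1 - a n / real (k n)) \<longlonglongrightarrow> 1"
    using tendsto_diff[OF tendsto_const a_over_k, of 1] by simp
  show "\<forall>\<^sub>F n in sequentially. 1 - a n / real (k n) \<le> weight n * real n / real (k n)"
    using eventually_ge_2 eventually_a_less_k
  proof eventually_elim
    case (elim n)
    show ?case using weight_ge[OF elim] k_range[OF elim(1)] by (simp add: field_simps)
  qed
  show "\<forall>\<^sub>F n in sequentially. weight n * real n / real (k n) \<le> 1"
    using eventually_ge_2
  proof eventually_elim
    case (elim n)
    show ?case using weight_le[OF elim] k_range[OF elim] by (simp add: field_simps)
  qed
qed auto

text \<open>The parameter \<open>y\<close> is a sequence rather than the fixed number
  \<open>x\<close>, because squaring \<open>A n + B n * x\<close> leaves lower-order terms that have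
  to be absorbed.\<close>

context
  fixes y u :: "nat \<Rightarrow> real" and x :: real
  assumes y: "y \<longlonglongrightarrow> x"
    and u: "\<And>n. u n = a n / real n * (1 - y n / real (k n))"
begin

abbreviation v :: "nat \<Rightarrow> real" where "v n \<equiv> 1 - y n / real (k n)"

lemma y_over_k: "(\<lambda>n. y n / real (k n)) \<longlonglongrightarrow> 0"
  using tendsto_mult[OF y inverse_k] by simp

lemma v_tendsto: "v \<longlonglongrightarrow> 1"
  using tendsto_diff[OF tendsto_const y_over_k, of 1] by simp

lemma u_tendsto: "u \<longlonglongrightarrow> 0"
  unfolding u using tendsto_mult[OF a_over_n v_tendsto] by simp

lemma eventually_u: "\<forall>\<^sub>F n in sequentially. 0 < v n \<and> 0 < u n \<and> u n < 1"
  using eventually_ge_2 order_tendstoD(1)[OF v_tendsto, of 0, simplified] order_tendstoD(2)[OF u_tendsto, of 1, simplified]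
proof eventually_elim
  case (elim n)
  have "0 < u n" unfolding u using a_pos[OF elim(1)] elim by (intro mult_pos_pos) auto
  with elim show ?case by auto
qed

lemma v_power: "(\<lambda>n. v n ^ k n) \<longlonglongrightarrow> exp (- x)"
proof -
  have "(\<lambda>n. (1 + - (y n / real (k n))) ^ k n * exp 0) \<longlonglongrightarrow> exp (- x)"
  proof (rule tendsto_power_exp)
    show "(\<lambda>n. - (y n / real (k n))) \<longlonglongrightarrow> 0"
      using tendsto_minus[OF y_over_k] by simp
    have "(\<lambda>n. y n * (y n / real (k n))) \<longlonglongrightarrow> 0"
      using tendsto_mult[OF y y_over_k] by simp
    then show "(\<lambda>n. real (k n) * (- (y n / real (k n)))\<^sup>2) \<longlonglongrightarrow> 0"
      by (rule Lim_transform_eventually)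
        (use eventually_ge_2 in \<open>eventually_elim, use k_range in \<open>force simp: power2_eq_square\<close>\<close>)
    show "(\<lambda>n. real (k n) * - (y n / real (k n)) + 0) \<longlonglongrightarrow> - x"
      by (rule Lim_transform_eventually[OF tendsto_minus[OF y]])
        (use eventually_ge_2 in \<open>eventually_elim, use k_range in force\<close>)
  qed
  then show ?thesis by simp
qed

text \<open>The product \<open>n * u n\<close> equals \<open>a n - y n * (a n / k n)\<close>, and
  the exponent falls short of \<open>n\<close> by \<open>k n + 1\<close>. Both corrections vanish in
  the limit, as does the second-order term \<open>n * (u n)^2\<close>, so the power behaves like
  \<open>exp (- a n)\<close>.\<close>

lemma complement_power: "(\<lambda>n. (1 - u n) ^ (n - Suc (k n)) * exp (a n)) \<longlonglongrightarrow> 1"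
proof -
  have ak_n: "(\<lambda>n. a n * (real (k n) + 1) / real n) \<longlonglongrightarrow> 0"
  proof (rule tendsto_sandwich[OF _ _ tendsto_const])
    show "(\<lambda>n. 2 * ((real (k n))\<^sup>2 / real n)) \<longlonglongrightarrow> 0"
      using tendsto_mult_left[OF k_square_over_n, of 2] by simp
    show "\<forall>\<^sub>F n in sequentially. 0 \<le> a n * (real (k n) + 1) / real n"
      using eventually_ge_2 by eventually_elim (use a_pos in \<open>auto intro!: mult_nonneg_nonneg less_imp_le\<close>)
    show "\<forall>\<^sub>F n in sequentially. a n * (real (k n) + 1) / real n \<le> 2 * ((real (k n))\<^sup>2 / real n)"
      using eventually_ge_2 eventually_a_less_k
    proof eventually_elim
      case (elim n)
      have "a n * (real (k n) + 1) \<le> real (k n) * (real (k n) + real (k n))"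
        using k_range[OF elim(1)] elim(2) by (intro mult_mono) auto
      then have "a n * (real (k n) + 1) / real n \<le> real (k n) * (real (k n) + real (k n)) / real n"
        by (rule divide_right_mono) simp
      then show ?case by (simp add: power2_eq_square mult_ac)
    qed
  qed
  have "(\<lambda>n. (1 + - u n) ^ (n - Suc (k n)) * exp (a n)) \<longlonglongrightarrow> exp 0"
  proof (rule tendsto_power_exp)
    show "(\<lambda>n. - u n) \<longlonglongrightarrow> 0" using tendsto_minus[OF u_tendsto] by simp
    show "(\<lambda>n. real (n - Suc (k n)) * (- u n)\<^sup>2) \<longlonglongrightarrow> 0"
    proof (rule tendsto_sandwich[OF _ _ tendsto_const])
      show "(\<lambda>n. a n * (real (k n) + 1) / real n * (v n)\<^sup>2) \<longlonglongrightarrow> 0"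
        using tendsto_mult[OF ak_n tendsto_power[OF v_tendsto, of 2]] by simp
      show "\<forall>\<^sub>F n in sequentially. real (n - Suc (k n)) * (- u n)\<^sup>2 \<le> a n * (real (k n) + 1) / real n * (v n)\<^sup>2"
        using eventually_ge_2 eventually_a_less_k
      proof eventually_elim
        case (elim n)
        have "real (n - Suc (k n)) * (- u n)\<^sup>2 \<le> real n * (u n)\<^sup>2"
          by (simp add: mult_right_mono)
        also have "\<dots> = a n * a n / real n * (v n)\<^sup>2"
          using elim by (simp add: u power2_eq_square)
        also have "\<dots> \<le> a n * (real (k n) + 1) / real n * (v n)\<^sup>2"
          using elim a_pos[OF elim(1)] by (intro mult_right_mono divide_right_mono mult_left_mono) auto
        finally show ?case .
      qed
    qed auto
    have "(\<lambda>n. y n * (a n / real (k n)) + a n * (real (k n) + 1) / real n * v n) \<longlonglongrightarrow> x * 0 + 0 * 1"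
      by (intro tendsto_add tendsto_mult y a_over_k ak_n v_tendsto)
    then show "(\<lambda>n. real (n - Suc (k n)) * - u n + a n) \<longlonglongrightarrow> 0"
    proof (rule Lim_transform_eventually[OF tendsto_eq_rhs])
      show "\<forall>\<^sub>F n in sequentially. y n * (a n / real (k n)) + a n * (real (k n) + 1) / real n * v n 
          = real (n - Suc (k n)) * - u n + a n"
        using eventually_ge_2
      proof eventually_elim
        case (elim n)
        have "real (n - Suc (k n)) = real n - (real (k n) + 1)"
          using k_range[OF elim] by (simp add: of_nat_diff)
        moreover have "real n * u n = a n - y n * (a n / real (k n))"
          using elim by (simp add: u algebra_simps)
        ultimately have "real (n - Suc (k n)) * - u n + a n = y n * (a n / real (k n)) + (real (k n) + 1) * u n"
          by (simp add: algebra_simps)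
        then show ?case by (simp add: u mult_ac)
      qed
    qed simp
  qed
  then show ?thesis by simp
qed

text \<open>This is the probability of the value \<open>k + 1\<close> divided by \<open>u\<close>.
  It splits into a falling factorial ratio, the weight ratio, \<open>k / (k + 1)\<close>, the power
  of \<open>v\<close> and the compensated power of \<open>1 - u\<close>; the compensator
  \<open>exp (a n)\<close> cancels the exponential in \<open>weight n\<close>.\<close>

lemma main_term: 
  "(\<lambda>n. real (n choose Suc (k n)) * u n ^ k n * (1 - u n) ^ (n - Suc (k n))) \<longlonglongrightarrow> exp (- x)"
proof -
  define \<gamma> where "\<gamma> n = real (n choose Suc (k n)) * fact (Suc (k n)) / real n ^ Suc (k n)" for n
  have \<gamma>: "\<gamma> \<longlonglongrightarrow> 1"
  proof (rule tendsto_sandwich[OF _ _ _ tendsto_const])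
    \<comment> \<open>The 4 comes from bounding \<open>k + 1\<close> by \<open>2 * k\<close> before
      squaring.\<close>
    have "(\<lambda>n. 1 - 4 * ((real (k n))\<^sup>2 / real n)) \<longlonglongrightarrow> 1 - 4 * 0"
      by (intro tendsto_intros k_square_over_n)
    then show "(\<lambda>n. 1 - 4 * ((real (k n))\<^sup>2 / real n)) \<longlonglongrightarrow> 1" by simp
    show "\<forall>\<^sub>F n in sequentially. 1 - 4 * ((real (k n))\<^sup>2 / real n) \<le> \<gamma> n"
      using eventually_ge_2
    proof eventually_elim
      case (elim n)
      have "(real (Suc (k n)))\<^sup>2 \<le> (2 * real (k n))\<^sup>2"
        using k_range[OF elim] by (intro power_mono) auto
      then have "(real (Suc (k n)))\<^sup>2 / real n \<le> (2 * real (k n))\<^sup>2 / real n"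
        by (rule divide_right_mono) simp
      moreover have "1 - (real (Suc (k n)))\<^sup>2 / real n \<le> \<gamma> n"
        unfolding \<gamma>_def by (rule binomial_falling_ratio) (use k_range[OF elim] in auto)
      ultimately show ?case by (simp add: power_mult_distrib)
    qed
    show "\<forall>\<^sub>F n in sequentially. \<gamma> n \<le> 1"
      using eventually_ge_2 unfolding \<gamma>_def
      by eventually_elim (rule binomial_falling_ratio, use k_range in \<open>auto simp: Suc_le_eq\<close>)
  qed
  have "(\<lambda>n. 1 / (1 + 1 / real (k n))) \<longlonglongrightarrow> 1 / (1 + 0)"
    by (intro tendsto_intros inverse_k) auto
  then have "(\<lambda>n. \<gamma> n * (weight n * real n / real (k n)) * (1 / (1 + 1 / real (k n))) * v n ^ k n *
      ((1 - u n) ^ (n - Suc (k n)) * exp (a n))) \<longlonglongrightarrow> 1 * 1 * (1 / (1 + 0)) * exp (- x) * 1"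
    by (intro tendsto_mult \<gamma> weight_ratio v_power complement_power)
  then show ?thesis
  proof (rule Lim_transform_eventually[OF tendsto_eq_rhs])
    show "\<forall>\<^sub>F n in sequentially. \<gamma> n * (weight n * real n / real (k n)) * (1 / (1 + 1 / real (k n))) * v n ^ k n *
      ((1 - u n) ^ (n - Suc (k n)) * exp (a n)) = real (n choose Suc (k n)) * u n ^ k n * (1 - u n) ^ (n - Suc (k n))"
      using eventually_ge_2
    proof eventually_elim
      case (elim n)
      have cancel: "c * (s * F) / (N * M) * (w * N / K) * (K / s) * E = c * (w * E * F) / M"
        if "K \<noteq> 0" "N \<noteq> 0" "s \<noteq> 0" for c s F N M w K E :: real
        using that by simp
      have k: "real (k n) > 0" "real n > 0" using k_range[OF elim] elim by auto
      then have "1 / (1 + 1 / real (k n)) = real (k n) / real (Suc (k n))"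
        by (simp add: field_simps)
      moreover have "weight n * exp (a n) * fact (k n) = a n ^ k n"
        by (simp add: weight_def exp_minus)
      ultimately have "\<gamma> n * (weight n * real n / real (k n)) * (1 / (1 + 1 / real (k n))) * exp (a n) 
        = real (n choose Suc (k n)) * (a n / real n) ^ k n"
        using cancel[of "real (k n)" "real n" "real (Suc (k n))" "real (n choose Suc (k n))" "fact (k n)" "real n ^ k n"
          "weight n" "exp (a n)"] k
        by (simp only: \<gamma>_def fact_Suc power_Suc power_divide) simp
      moreover have "u n ^ k n = (a n / real n) ^ k n * v n ^ k n"
        by (simp only: u power_mult_distrib)
      moreover have "G * W * S * V * (Q * E) = c * P * Q"
        if "G * W * S * E = c * D" "P = D * V" for G W S V Q E c D P :: real
      proof -
        have "G * W * S * V * (Q * E) = (G * W * S * E) * V * Q" by (simp only: mult_ac)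
        then show ?thesis unfolding that by (simp only: mult_ac)
      qed
      ultimately show ?case by blast
    qed
  qed simp
qed

text \<open>The sum is the mean excess over \<open>k\<close> divided by \<open>u\<close>. It is
  squeezed between the contribution of the atom at \<open>k + 1\<close> and that contribution times
  a geometric correction, whose ratio tends to 0 together with \<open>a n / k n\<close>.\<close>

lemma tail_sum: "(\<lambda>n. \<Sum>j<n - k n. binomial_tail (u n) (j + k n) (k n)) \<longlonglongrightarrow> exp (- x)"
proof -
  define R where "R n = real (n choose Suc (k n)) * u n ^ k n * (1 - u n) ^ (n - Suc (k n))" for n
  \<comment> \<open>The ratio bound \<open>n * u / (k * (1 - u))\<close> with the formula for
    \<open>u\<close> inserted, so that the factor \<open>a n / k n\<close> is visible.\<close>
  define \<rho> where "\<rho> n = a n / real (k n) * v n / (1 - u n)" for n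
  have R: "R \<longlonglongrightarrow> exp (- x)" unfolding R_def by (rule main_term)
  have "\<rho> \<longlonglongrightarrow> 0 * 1 / (1 - 0)"
    unfolding \<rho>_def by (intro tendsto_intros a_over_k v_tendsto u_tendsto) auto
  then have \<rho>: "\<rho> \<longlonglongrightarrow> 0" by simp
  have eq: "\<forall>\<^sub>F n in sequentially. (\<Sum>j<n - k n. binomial_tail (u n) (j + k n) (k n)) 
      = binomial_mean (u n) n (\<lambda>i. real (i - k n)) / u n"
    using eventually_ge_2 eventually_u
  proof eventually_elim
    case (elim n)
    then show ?case
      using sum_shifted_binomial_tail[of "k n" n "u n"] k_range[of n] by (simp add: field_simps)
  qed
  show ?thesis
  proof (rule tendsto_sandwich[OF _ _ R])
    show "\<forall>\<^sub>F n in sequentially. R n \<le> (\<Sum>j<n - k n. binomial_tail (u n) (j + k n) (k n))"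
      using eventually_ge_2 eventually_u eq
    proof eventually_elim
      case (elim n)
      have "R n * u n \<le> binomial_mean (u n) n (\<lambda>i. real (i - k n))"
        using binomial_excess_ge[of "u n" "k n" n] k_range[of n] elim by (simp add: R_def mult_ac)
      then show ?case
        unfolding elim(3) using elim by (simp add: pos_le_divide_eq)
    qed
    have "(\<lambda>n. R n / (1 - \<rho> n)\<^sup>2) \<longlonglongrightarrow> exp (- x) / (1 - 0)\<^sup>2"
      by (intro tendsto_intros R \<rho>) auto
    then show "(\<lambda>n. R n / (1 - \<rho> n)\<^sup>2) \<longlonglongrightarrow> exp (- x)" by simp
    show "\<forall>\<^sub>F n in sequentially. (\<Sum>j<n - k n. binomial_tail (u n) (j + k n) (k n)) \<le> R n / (1 - \<rho> n)\<^sup>2"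
      using eventually_ge_2 eventually_u eq order_tendstoD(2)[OF \<rho>, of 1, simplified]
    proof eventually_elim
      case (elim n)
      have k: "0 < k n" "k n < n" using k_range[OF elim(1)] by auto
      have "real n * u n / (real (k n) * (1 - u n)) = \<rho> n"
        using elim by (simp add: u \<rho>_def)
      then have "binomial_mean (u n) n (\<lambda>i. real (i - k n)) / u n 
          \<le> (real (n choose Suc (k n)) * u n ^ Suc (k n) * (1 - u n) ^ (n - Suc (k n)) / (1 - \<rho> n)\<^sup>2) / u n"
        using elim k by (intro divide_right_mono binomial_excess_le) auto
      also have "\<dots> = R n / (1 - \<rho> n)\<^sup>2"
        using elim by (simp add: R_def)
      finally show ?case unfolding elim(3) .
    qed
  qed
qed

text \<open>What remains is uniform smallness of the tails. The union bound gives at most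
  \<open>(n * u)^k / k!\<close>, which is \<open>weight n * exp (a n) * v n ^ k n\<close>; since
  \<open>a n < k n\<close> and the weight is at most \<open>k n / n\<close>, this tends to
  0.\<close>

lemma tail_prod: "(\<lambda>n. \<Prod>j<n - k n. 1 - binomial_tail (u n) (j + k n) (k n)) \<longlonglongrightarrow> exp (- exp (- x))"
proof (rule tendsto_prod_one_minus[OF _ _ tail_sum])
  define \<delta> where "\<delta> n = real (k n) * exp (real (k n)) / real n * v n ^ k n" for n
  have "\<delta> \<longlonglongrightarrow> 0 * exp (- x)"
    unfolding \<delta>_def by (intro tendsto_mult k_exp_k_over_n v_power)
  then show "\<delta> \<longlonglongrightarrow> 0" by simp
  show "\<forall>\<^sub>F n in sequentially. \<forall>j<n - k n. 0 \<le> binomial_tail (u n) (j + k n) (k n) \<and>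
       binomial_tail (u n) (j + k n) (k n) \<le> 1 \<and> binomial_tail (u n) (j + k n) (k n) \<le> \<delta> n"
    using eventually_ge_2 eventually_u eventually_a_less_k
  proof eventually_elim
    case (elim n)
    show ?case
    proof (intro allI impI conjI)
      fix j assume j: "j < n - k n"
      show "0 \<le> binomial_tail (u n) (j + k n) (k n)" "binomial_tail (u n) (j + k n) (k n) \<le> 1"
        using elim by (auto intro!: binomial_tail_bounds)
      have "(j + k n choose k n) * fact (k n) \<le> (n choose k n) * fact (k n)"
        using j by (intro mult_right_mono binomial_right_mono) auto
      also have "\<dots> \<le> n ^ k n"
        by (rule binomial_fact_pow)
      finally have "real ((j + k n choose k n) * fact (k n)) \<le> real (n ^ k n)"
        by (simp only: of_nat_le_iff)
      then have "real (j + k n choose k n) \<le> real n ^ k n / fact (k n)"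
        by (simp add: pos_le_divide_eq)
      then have "real (j + k n choose k n) * u n ^ k n \<le> real n ^ k n / fact (k n) * u n ^ k n"
        using elim by (intro mult_right_mono) auto
      then have "binomial_tail (u n) (j + k n) (k n) \<le> real n ^ k n / fact (k n) * u n ^ k n"
        using binomial_tail_le[of "u n" "j + k n" "k n"] elim by simp
      also have "\<dots> = weight n * exp (a n) * v n ^ k n"
        using elim by (simp add: u weight_def power_mult_distrib power_divide exp_minus)
      also have "\<dots> \<le> real (k n) / real n * exp (real (k n)) * v n ^ k n"
        using elim weight_le[OF elim(1)] by (intro mult_right_mono mult_mono) auto
      finally show "binomial_tail (u n) (j + k n) (k n) \<le> \<delta> n"
        by (simp add: \<delta>_def)
    qed
  qed
qed

end

end

section \<open>Weak convergence of the normalized maximum\<close>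

theorem theorem3:
  fixes p k :: "nat \<Rightarrow> nat"
    and M :: "nat \<Rightarrow> 'w measure"
    and U :: "nat \<Rightarrow> 'w \<Rightarrow> complex mat"
    and z :: "nat \<Rightarrow> nat \<Rightarrow> 'w \<Rightarrow> complex"
    and C a A B :: "nat \<Rightarrow> real"
  assumes p_range: "\<And>n. n \<ge> 2 \<Longrightarrow> 1 \<le> p n \<and> p n < n"
    and k_eq: "\<And>n. k n = n - p n"
    and prob: "\<And>n. n \<ge> 2 \<Longrightarrow> prob_space (M n)"
    and haar: "\<And>n. n \<ge> 2 \<Longrightarrow> haar_unitary (M n) n (U n)"
    and eigenvalues: "\<And>n \<omega>. n \<ge> 2 \<Longrightarrow> \<omega> \<in> space (M n) \<Longrightarrow>
           eigenvalue_list (truncation (p n) (U n \<omega>)) (p n) (\<lambda>j. z n j \<omega>)"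
    and joint_density: "\<And>n. n \<ge> 2 \<Longrightarrow>
           distributed (M n) (Pi\<^sub>M {..<p n} (\<lambda>_. lborel))
             (\<lambda>\<omega>. \<lambda>j\<in>{..<p n}. z n j \<omega>)
             (truncated_eigenvalue_density n (p n) (C n))"
    and k_at_top: "filterlim k at_top sequentially"
    and k_over_log: "(\<lambda>n. real (k n) / ln (real n)) \<longlonglongrightarrow> 0"
    and a_pos: "\<And>n. n \<ge> 2 \<Longrightarrow> a n > 0"
    and a_eq: "\<And>n. n \<ge> 2 \<Longrightarrow>
           1 / fact (k n - 1) * integral {0..a n} (\<lambda>t. t ^ (k n - 1) * exp (- t))
             = real (k n) / real n"
    and A_eq: "\<And>n. A n = sqrt (1 - a n / real n)"
    and B_eq: "\<And>n. B n = a n / (2 * real n * real (k n))"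
  shows "weak_conv
           (\<lambda>n. cdf (distr (M n) borel
              (\<lambda>\<omega>. (Max ((\<lambda>j. cmod (z n j \<omega>)) ` {..<p n}) - A n) / B n)))
           gumbel_cdf"
proof -
  interpret gumbel_scaling k a
    by unfold_locales (use p_range k_eq k_at_top k_over_log a_pos a_eq in \<open>force+\<close>)
  have A_lim: "A \<longlonglongrightarrow> 1"
    unfolding A_eq using tendsto_real_sqrt[OF tendsto_diff[OF tendsto_const a_over_n, of 1]] by simp
  have "(\<lambda>n. a n / real n * (1 / real (k n)) / 2) \<longlonglongrightarrow> 0 * 0 / 2"
    by (intro tendsto_intros a_over_n inverse_k) auto
  then have B_lim: "B \<longlonglongrightarrow> 0"
    unfolding B_eq by (simp add: mult_ac)
  show ?thesis
    unfolding weak_conv_def gumbel_cdf_def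
  proof (intro allI impI)
    fix x :: real
    \<comment> \<open>Read off from the square of \<open>A n + B n * x\<close>: the cross term gives
      \<open>A n * x\<close> and the square of \<open>B n * x\<close> gives the other summand, after
      taking out \<open>a n / (n * k n)\<close>. With this choice \<open>1 - (r n)^2\<close> equals
      \<open>u n\<close> exactly.\<close>
    define y where "y n = A n * x + a n / real n * (1 / real (k n)) * (x\<^sup>2 / 4)" for n
    define u where "u n = a n / real n * (1 - y n / real (k n))" for n
    define r where "r n = A n + B n * x" for n
    have "y \<longlonglongrightarrow> 1 * x + 0 * 0 * (x\<^sup>2 / 4)"
      unfolding y_def by (intro tendsto_intros A_lim a_over_n inverse_k)
    then have y: "y \<longlonglongrightarrow> x" by simp
    have "r \<longlonglongrightarrow> 1 + 0 * x"
      unfolding r_def by (intro tendsto_intros A_lim B_lim)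
    then have r: "r \<longlonglongrightarrow> 1" by simp
    have "\<forall>\<^sub>F n in sequentially. (\<Prod>j<n - k n. 1 - binomial_tail (u n) (j + k n) (k n)) = 
        cdf (distr (M n) borel (\<lambda>\<omega>. (Max ((\<lambda>j. cmod (z n j \<omega>)) ` {..<p n}) - A n) / B n)) x"
      using eventually_ge_2 eventually_u[OF y u_def] eventually_a_less_k order_tendstoD(1)[OF r, of 0, simplified]
    proof eventually_elim
      case (elim n)
      have p: "1 \<le> p n" "p n < n" "k n = n - p n" "p n = n - k n"
        using p_range[OF elim(1)] k_eq[of n] by auto
      have pos: "0 < a n" "0 < real n" "0 < real (k n)" using a_pos[OF elim(1)] elim(1) p(2,3) by auto
      \<comment> \<open>Keeps the argument of the square root in \<open>A n\<close> nonnegative, so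
        that squaring undoes the root.\<close>
      have "a n < real n" using elim(3) p(2,3) by linarith
      then have "a n / real n \<le> 1" using pos by (simp add: divide_le_eq_1)
      then have "(A n)\<^sup>2 = 1 - a n / real n" unfolding A_eq by simp
      moreover have "(r n)\<^sup>2 = (A n)\<^sup>2 + 2 * A n * B n * x + (B n)\<^sup>2 * x\<^sup>2"
        by (simp add: r_def power2_eq_square algebra_simps)
      moreover have "2 * A n * B n * x + (B n)\<^sup>2 * x\<^sup>2 = a n / real n * (y n / real (k n))"
        using pos by (simp add: B_eq y_def power2_eq_square field_simps)
      ultimately have r2: "1 - (r n)\<^sup>2 = u n"
        by (simp add: u_def algebra_simps)
      have r1: "r n < 1"
      proof (rule ccontr)
        assume "\<not> r n < 1"
        then have "1 \<le> (r n)\<^sup>2" by (simp add: one_le_power)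
        with r2 elim(2) show False by simp
      qed
      have B: "0 < B n" unfolding B_eq using pos by simp
      let ?X = "\<lambda>\<omega>. (Max ((\<lambda>j. cmod (z n j \<omega>)) ` {..<p n}) - A n) / B n"
      have "z n j \<in> borel_measurable (M n)" if "j \<in> {..<p n}" for j
        using measurable_compose[OF distributed_measurable[OF joint_density[OF elim(1)]] 
            measurable_component_singleton[OF that]] that by simp
      then have [measurable]: "?X \<in> borel_measurable (M n)"
        by (intro borel_measurable_divide borel_measurable_diff borel_measurable_Max borel_measurable_norm) auto
      have "cdf (distr (M n) borel ?X) x = measure (M n) (?X -` {..x} \<inter> space (M n))"
        by (simp add: cdf_def measure_distr)
      also have "?X -` {..x} \<inter> space (M n) = {\<omega> \<in> space (M n). \<forall>j<p n. cmod (z n j \<omega>) \<le> r n}"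
      proof -
        have "?X \<omega> \<le> x \<longleftrightarrow> (\<forall>j<p n. cmod (z n j \<omega>) \<le> r n)" for \<omega>
        proof -
          have "?X \<omega> \<le> x \<longleftrightarrow> Max ((\<lambda>j. cmod (z n j \<omega>)) ` {..<p n}) \<le> r n"
            using B by (simp add: pos_divide_le_eq r_def algebra_simps)
          \<comment> \<open>The maximum is taken over a nonempty set because \<open>p n\<close> is
            at least 1.\<close>
          also have "\<dots> \<longleftrightarrow> (\<forall>j<p n. cmod (z n j \<omega>) \<le> r n)"
            using p(1) by (subst Max_le_iff) (auto simp: lessThan_empty_iff)
          finally show ?thesis .
        qed
        then show ?thesis by auto
      qed
      also have "measure (M n) \<dots> = (\<Prod>j<p n. 1 - binomial_tail (1 - (r n)\<^sup>2) (j + (n - p n)) (n - p n))"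
        by (rule prob_all_cmod_le[OF prob[OF elim(1)] p(2) _ r1 joint_density[OF elim(1)]]) (use elim(4) in simp)
      also have "\<dots> = (\<Prod>j<n - k n. 1 - binomial_tail (u n) (j + k n) (k n))"
        unfolding r2 p(3)[symmetric] by (subst (1) p(4)) (rule refl)
      finally show ?case ..
    qed
    then show "(\<lambda>n. cdf (distr (M n) borel (\<lambda>\<omega>. (Max ((\<lambda>j. cmod (z n j \<omega>)) ` {..<p n}) - A n) / B n)) x)
        \<longlonglongrightarrow> exp (- exp (- x))"
      by (rule Lim_transform_eventually[OF tail_prod[OF y u_def]])
  qed
qed

end
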